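(* Let $K$ be a real compact nc convex set with complexification $K_c$, and let $x \in K_c$. Then $x$ is maximal in the complex nc convex set $K_c$ if and only if $c(x)$ is maximal in the real nc convex set $K$.
   Context: Let $\mathbb F=\mathbb R$ or $\mathbb C$, and let $M_{m,n}=M_{m,n}(\mathbb F)$, $M_n = M_n(\mathbb F)$ denote bounded operators between Hilbert spaces $\ell^2_n,\ell^2_m$ for (possibly infinite) cardinals; for an operator space $E$ and a cardinal $n$, $M_n(E)$ is the space of $n\times n$ matrices over $E$ whose finitely supported submatrices are uniformly bounded. Fix a large enough infinite cardinal $\kappa$ (e.g. at least the cardinality of $E$); all cardinals $n,m,\dots$ are nonzero and $\le\kappa$, and $\mathcal M(E)=\bigsqcup_{n\le\kappa}M_n(E)$. A real (resp. complex) nc convex set over a real (resp. complex) dual operator space $E$ is a subset $K=\bigsqcup_n K_n\subseteq\mathcal M(E)$, $K_n\subseteq M_n(E)$, closed under direct sums ($\sum_i\alpha_i x_i\alpha_i^*\in K_n$ whenever $(x_i)$ is a bounded family with $x_i\in K_{n_i}$ and $\alpha_i\in M_{n,n_i}(\mathbb F)$ are isometries with $\sum_i\alpha_i\alpha_i^*=1_n$) and under compressions ($\beta^*x\beta\in K_m$ for $x\in K_n$ and isometries $\beta\in M_{n,m}(\mathbb F)$). It is compact if each $K_n$ is compact in the (point-)weak* topology. Complexification: for $x,y\in M_n(E)$ put $c(x+iy)=c(x,y)=\begin{bmatrix} x & -y \\ y & x \end{bmatrix}\in M_{2n}(E)$. For a real nc convex set $K\subseteq\mathcal M(E)$, $K_c\subseteq\mathcal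 M(E_c)$ is the complex nc convex set with $(K_c)_n=\{x+iy: x,y\in M_n(E),\ c(x,y)\in K_{2n}\}$. Maximal: for $x\in K_m$, $y\in K_n$, $y$ is a dilation of $x$ if $x=\alpha^*y\alpha$ for an isometry $\alpha\in M_{n,m}(\mathbb F)$; the dilation is trivial if $y$ commutes with the projection $\alpha\alpha^*$. The point $x\in K$ is maximal if every dilation of $x$ (in $K$) is trivial. The scalars $\mathbb F$ are $\mathbb R$ for a real nc convex set and $\mathbb C$ for a complex one. *)

theory Defs
  imports "HOL-Analysis.Analysis" "Jordan_Normal_Form.Conjugate"
begin

text \<open>
  The cardinal \<open>\<kappa>\<close> is that of an infinite type \<open>'k\<close>. A nonzero cardinal \<open>n \<le> \<kappa>\<close> is represented by
  the nonempty sets \<open>I :: 'k set\<close> with \<open>n\<close> elements, and \<open>n \<times> n\<close> matrices are functions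
  \<open>'k \<Rightarrow> 'k \<Rightarrow> _\<close> that vanish outside \<open>I \<times> I\<close>. Several index sets represent the same cardinal;
  since an nc convex set is closed under compressions by the permutation unitaries between them,
  its levels at equinumerous index sets determine each other.
\<close>


section \<open>Scalar matrices\<close>

text \<open>The operator from \<open>\<ell>\<^sup>2(T)\<close> to \<open>\<ell>\<^sup>2(S)\<close> with matrix \<open>\<alpha>\<close> has norm at most \<open>C\<close>; for finite \<open>S\<close>, \<open>T\<close>.\<close>

definition op_norm_le :: "'a set \<Rightarrow> 'b set \<Rightarrow> ('a \<Rightarrow> 'b \<Rightarrow> 'f::real_normed_field) \<Rightarrow> real \<Rightarrow> bool" where
  "op_norm_le S T \<alpha> C \<longleftrightarrow> 0 \<le> C \<and>
     (\<forall>\<xi>. L2_set (\<lambda>s. norm (\<Sum>t\<in>T. \<alpha> s t * \<xi> t)) S \<le> C * L2_set (\<lambda>t. norm (\<xi> t)) T)"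

text \<open>The space \<open>M\<^bsub>J,I\<^esub>(\<bbbF>)\<close> of (matrices of) bounded operators \<open>\<ell>\<^sup>2(I) \<rightarrow> \<ell>\<^sup>2(J)\<close>.\<close>

definition scalar_mats :: "'k set \<Rightarrow> 'k set \<Rightarrow> ('k \<Rightarrow> 'k \<Rightarrow> 'f::real_normed_field) set" where
  "scalar_mats J I = {\<alpha>. (\<forall>j i. \<alpha> j i \<noteq> 0 \<longrightarrow> j \<in> J \<and> i \<in> I) \<and>
     (\<exists>C. \<forall>S T. finite S \<and> S \<subseteq> J \<and> finite T \<and> T \<subseteq> I \<longrightarrow> op_norm_le S T \<alpha> C)}"

definition adj :: "('k \<Rightarrow> 'k \<Rightarrow> 'f::conjugate) \<Rightarrow> 'k \<Rightarrow> 'k \<Rightarrow> 'f" where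
  "adj \<alpha> = (\<lambda>i j. conjugate (\<alpha> j i))"

definition id_mat :: "'k set \<Rightarrow> 'k \<Rightarrow> 'k \<Rightarrow> 'f::zero_neq_one" where
  "id_mat I = (\<lambda>i j. if i = j \<and> i \<in> I then 1 else 0)"

text \<open>
  Products \<open>\<alpha> x\<close> and \<open>x \<beta>\<close> of a scalar matrix with a matrix over a vector space with scalar
  multiplication \<open>sc\<close>. For a bounded scalar matrix and a bounded matrix over a complete operator
  space the sums defining the entries converge in norm.
\<close>

definition lmul :: "('f \<Rightarrow> 'e \<Rightarrow> 'e) \<Rightarrow> ('k \<Rightarrow> 'k \<Rightarrow> 'f) \<Rightarrow> ('k \<Rightarrow> 'k \<Rightarrow> 'e)
    \<Rightarrow> 'k \<Rightarrow> 'k \<Rightarrow> 'e::{comm_monoid_add,t2_space}" where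
  "lmul sc \<alpha> x = (\<lambda>p l. \<Sum>\<^sub>\<infinity>k. sc (\<alpha> p k) (x k l))"

definition rmul :: "('f \<Rightarrow> 'e \<Rightarrow> 'e) \<Rightarrow> ('k \<Rightarrow> 'k \<Rightarrow> 'e) \<Rightarrow> ('k \<Rightarrow> 'k \<Rightarrow> 'f)
    \<Rightarrow> 'k \<Rightarrow> 'k \<Rightarrow> 'e::{comm_monoid_add,t2_space}" where
  "rmul sc x \<beta> = (\<lambda>k q. \<Sum>\<^sub>\<infinity>l. sc (\<beta> l q) (x k l))"

text \<open>Isometries \<open>\<ell>\<^sup>2(I) \<rightarrow> \<ell>\<^sup>2(J)\<close>.\<close>

definition isometries ::
    "'k set \<Rightarrow> 'k set \<Rightarrow> ('k \<Rightarrow> 'k \<Rightarrow> 'f::{conjugatable_field,real_normed_field}) set" where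
  "isometries J I = {\<alpha> \<in> scalar_mats J I. lmul (*) (adj \<alpha>) \<alpha> = id_mat I}"


section \<open>Real dual operator spaces\<close>

text \<open>
  Real operator spaces, given by Ruan's axioms: \<open>nV n\<close> is the norm of \<open>M\<^sub>n(V)\<close>, evaluated at the
  upper left \<open>n \<times> n\<close> corner of its argument.
\<close>

definition real_operator_space :: "(nat \<Rightarrow> (nat \<Rightarrow> nat \<Rightarrow> 'v::real_normed_vector) \<Rightarrow> real) \<Rightarrow> bool" where
  "real_operator_space nV \<longleftrightarrow>
     (\<forall>n x y. (\<forall>i<n. \<forall>j<n. x i j = y i j) \<longrightarrow> nV n x = nV n y) \<and>
     (\<forall>n x. nV n x = 0 \<longleftrightarrow> (\<forall>i<n. \<forall>j<n. x i j = 0)) \<and>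
     (\<forall>n x y. nV n (\<lambda>i j. x i j + y i j) \<le> nV n x + nV n y) \<and>
     (\<forall>n r x. nV n (\<lambda>i j. r *\<^sub>R x i j) = \<bar>r\<bar> * nV n x) \<and>
     (\<forall>v. nV 1 (\<lambda>i j. v) = norm v) \<and>
     (\<forall>m n x y. nV (m + n) (\<lambda>i j. if i < m \<and> j < m then x i j
                                  else if m \<le> i \<and> m \<le> j then y (i - m) (j - m) else 0)
                 = max (nV m x) (nV n y)) \<and>
     (\<forall>m n x (\<alpha> :: nat \<Rightarrow> nat \<Rightarrow> real) \<beta> a b.
        op_norm_le {..<m} {..<n} \<alpha> a \<and> op_norm_le {..<n} {..<m} \<beta> b \<longrightarrow>
        nV m (\<lambda>i j. \<Sum>k<n. \<Sum>l<n. (\<alpha> i k * \<beta> l j) *\<^sub>R x k l) \<le> a * nV n x * b)"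

text \<open>
  A real dual operator space is the operator space dual \<open>E = V\<^sup>*\<close> of a complete real operator space
  \<open>V\<close>; its matrix norms come from \<open>M\<^bsub>n\<^esub>(E) = CB(V, M\<^bsub>n\<^esub>(\<real>))\<close>. For finite \<open>S\<close>,
  \<open>dual_norm_le nV S x C\<close> says that the submatrix of \<open>x\<close> on \<open>S \<times> S\<close> has norm at most \<open>C\<close>.
\<close>

type_synonym 'v dual = "'v \<Rightarrow>\<^sub>L real"

definition dual_norm_le :: "(nat \<Rightarrow> (nat \<Rightarrow> nat \<Rightarrow> 'v) \<Rightarrow> real) \<Rightarrow> 'k set
    \<Rightarrow> ('k \<Rightarrow> 'k \<Rightarrow> ('v::banach) dual) \<Rightarrow> real \<Rightarrow> bool" where
  "dual_norm_le nV S x C \<longleftrightarrow> 0 \<le> C \<and>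
     (\<forall>n v. op_norm_le (S \<times> {..<n}) (S \<times> {..<n})
        (\<lambda>(i, p) (j, q). blinfun_apply (x i j) (v p q)) (C * nV n v))"

text \<open>\<open>M\<^sub>I(E)\<close>\<close>

definition dual_mats :: "(nat \<Rightarrow> (nat \<Rightarrow> nat \<Rightarrow> 'v) \<Rightarrow> real) \<Rightarrow> 'k set
    \<Rightarrow> ('k \<Rightarrow> 'k \<Rightarrow> ('v::banach) dual) set" where
  "dual_mats nV I = {x. (\<forall>i j. x i j \<noteq> 0 \<longrightarrow> i \<in> I \<and> j \<in> I) \<and>
     (\<exists>C. \<forall>S. finite S \<and> S \<subseteq> I \<longrightarrow> dual_norm_le nV S x C)}"

text \<open>
  The point-weak* topology on \<open>M\<^sub>I(E)\<close>: the coarsest one for which \<open>x \<mapsto> \<phi> [x\<^sub>i\<^sub>j(v)]\<close> is continuous for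
  all \<open>v \<in> V\<close> and all weak* continuous functionals \<open>\<phi>\<close> on \<open>B(\<ell>\<^sup>2(I))\<close>, that is, all functionals
  \<open>\<phi> T = (\<Sum>r. \<langle>T \<xi>\<^sub>r, \<eta>\<^sub>r\<rangle>)\<close> with square-summable sequences \<open>\<xi>\<close>, \<open>\<eta>\<close> of vectors.
\<close>

definition sq_summable :: "(nat \<Rightarrow> 'k \<Rightarrow> real) \<Rightarrow> bool" where
  "sq_summable \<xi> \<longleftrightarrow> (\<lambda>(r, i). (\<xi> r i)\<^sup>2) summable_on UNIV"

definition weakstar_functional :: "'v::banach \<Rightarrow> (nat \<Rightarrow> 'k \<Rightarrow> real) \<Rightarrow> (nat \<Rightarrow> 'k \<Rightarrow> real)
    \<Rightarrow> ('k \<Rightarrow> 'k \<Rightarrow> 'v dual) \<Rightarrow> real" where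
  "weakstar_functional v \<xi> \<eta> x =
     (\<Sum>\<^sub>\<infinity>r. \<Sum>\<^sub>\<infinity>i. (\<Sum>\<^sub>\<infinity>j. blinfun_apply (x i j) v * \<xi> r j) * \<eta> r i)"

definition weakstar_topology :: "(nat \<Rightarrow> (nat \<Rightarrow> nat \<Rightarrow> 'v) \<Rightarrow> real) \<Rightarrow> 'k set
    \<Rightarrow> ('k \<Rightarrow> 'k \<Rightarrow> ('v::banach) dual) topology" where
  "weakstar_topology nV I = topology_generated_by
     {{x \<in> dual_mats nV I. weakstar_functional v \<xi> \<eta> x \<in> U} | v \<xi> \<eta> U.
        sq_summable \<xi> \<and> sq_summable \<eta> \<and> open U}"


section \<open>Real compact nc convex sets\<close>

text \<open>
  In a direct sum the \<open>\<alpha> i\<close> have nonzero, mutually orthogonal ranges in \<open>\<ell>\<^sup>2(I)\<close>, so the family has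
  at most \<open>\<kappa>\<close> members and may be indexed by a subset \<open>L\<close> of \<open>'k\<close>. The condition
  \<open>(\<Sum>i\<in>L. \<alpha> i \<alpha> i\<^sup>*) = 1\<close> is stated entrywise, and the entries of \<open>\<Sum>i\<in>L. \<alpha> i x i \<alpha> i\<^sup>*\<close> are absolutely
  convergent sums since \<open>x\<close> is bounded.
\<close>

definition real_nc_convex :: "(nat \<Rightarrow> (nat \<Rightarrow> nat \<Rightarrow> 'v) \<Rightarrow> real)
    \<Rightarrow> ('k set \<Rightarrow> ('k \<Rightarrow> 'k \<Rightarrow> ('v::banach) dual) set) \<Rightarrow> bool" where
  "real_nc_convex nV K \<longleftrightarrow>
     (\<forall>I. I \<noteq> {} \<longrightarrow> K I \<subseteq> dual_mats nV I) \<and>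
     (\<forall>I L N x (\<alpha> :: 'k \<Rightarrow> 'k \<Rightarrow> 'k \<Rightarrow> real).
        I \<noteq> {} \<and>
        (\<forall>i\<in>L. N i \<noteq> {} \<and> x i \<in> K (N i) \<and> \<alpha> i \<in> isometries I (N i)) \<and>
        (\<exists>C. \<forall>i\<in>L. \<forall>S. finite S \<and> S \<subseteq> N i \<longrightarrow> dual_norm_le nV S (x i) C) \<and>
        (\<forall>p q. ((\<lambda>i. lmul (*) (\<alpha> i) (adj (\<alpha> i)) p q) has_sum id_mat I p q) L)
        \<longrightarrow> (\<lambda>p q. \<Sum>\<^sub>\<infinity>i\<in>L. lmul scaleR (\<alpha> i) (rmul scaleR (x i) (adj (\<alpha> i))) p q) \<in> K I) \<and>
     (\<forall>I J x (\<beta> :: 'k \<Rightarrow> 'k \<Rightarrow> real).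
        I \<noteq> {} \<and> J \<noteq> {} \<and> x \<in> K J \<and> \<beta> \<in> isometries J I
        \<longrightarrow> lmul scaleR (adj \<beta>) (rmul scaleR x \<beta>) \<in> K I)"

definition real_compact_nc_convex :: "(nat \<Rightarrow> (nat \<Rightarrow> nat \<Rightarrow> 'v) \<Rightarrow> real)
    \<Rightarrow> ('k set \<Rightarrow> ('k \<Rightarrow> 'k \<Rightarrow> ('v::banach) dual) set) \<Rightarrow> bool" where
  "real_compact_nc_convex nV K \<longleftrightarrow> real_nc_convex nV K \<and>
     (\<forall>I. I \<noteq> {} \<longrightarrow> compactin (weakstar_topology nV I) (K I))"


section \<open>Maximal points\<close>

text \<open>
  Over \<open>\<real>\<close> or \<open>\<complex>\<close>, according to the scalar multiplication \<open>sc\<close>; \<open>maximal sc K I x\<close> is about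
  \<open>x\<close> as an element of the level \<open>K I\<close>.
\<close>

definition dilation :: "('f \<Rightarrow> 'e \<Rightarrow> 'e) \<Rightarrow> 'k set \<Rightarrow> ('k \<Rightarrow> 'k \<Rightarrow> 'e::{comm_monoid_add,t2_space}) \<Rightarrow> 'k set \<Rightarrow> ('k \<Rightarrow> 'k \<Rightarrow> 'e)
    \<Rightarrow> ('k \<Rightarrow> 'k \<Rightarrow> 'f::{conjugatable_field,real_normed_field}) \<Rightarrow> bool" where
  "dilation sc I x J y \<alpha> \<longleftrightarrow> \<alpha> \<in> isometries J I \<and> x = lmul sc (adj \<alpha>) (rmul sc y \<alpha>)"

definition trivial_dilation :: "('f \<Rightarrow> 'e \<Rightarrow> 'e) \<Rightarrow> ('k \<Rightarrow> 'k \<Rightarrow> 'e::{comm_monoid_add,t2_space})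
    \<Rightarrow> ('k \<Rightarrow> 'k \<Rightarrow> 'f::{conjugatable_field,real_normed_field}) \<Rightarrow> bool" where
  "trivial_dilation sc y \<alpha> \<longleftrightarrow>
     rmul sc y (lmul (*) \<alpha> (adj \<alpha>)) = lmul sc (lmul (*) \<alpha> (adj \<alpha>)) y"

definition maximal :: "('f::{conjugatable_field,real_normed_field} \<Rightarrow> 'e \<Rightarrow> 'e)
    \<Rightarrow> ('k set \<Rightarrow> ('k \<Rightarrow> 'k \<Rightarrow> 'e::{comm_monoid_add,t2_space}) set)
    \<Rightarrow> 'k set \<Rightarrow> ('k \<Rightarrow> 'k \<Rightarrow> 'e) \<Rightarrow> bool" where
  "maximal sc K I x \<longleftrightarrow> x \<in> K I \<and>
     (\<forall>J y \<alpha>. J \<noteq> {} \<and> y \<in> K J \<and> dilation sc I x J y \<alpha> \<longrightarrow> trivial_dilation sc y \<alpha>)"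


section \<open>Complexification\<close>

text \<open>
  \<open>E\<^sub>c = E + \<i>E\<close> is realised on \<open>'e \<times> 'e\<close>, the pair \<open>(a, b)\<close> standing for \<open>a + \<i>b\<close>. Its norm is
  equivalent to the product norm, so it has the topology of the product type.
\<close>

definition scaleC_pair :: "complex \<Rightarrow> 'e \<times> 'e \<Rightarrow> 'e \<times> 'e::real_vector" where
  "scaleC_pair c z = (Re c *\<^sub>R fst z - Im c *\<^sub>R snd z, Re c *\<^sub>R snd z + Im c *\<^sub>R fst z)"

text \<open>
  A fixed bijection \<open>\<kappa> + \<kappa> = \<kappa>\<close> turns \<open>I + I\<close> into the index set \<open>double I\<close> of cardinality \<open>2n\<close>, and
  identifies \<open>\<ell>\<^sup>2(I) \<oplus> \<ell>\<^sup>2(I)\<close> with \<open>\<ell>\<^sup>2(double I)\<close>.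
\<close>

definition fold_sum :: "'k + 'k \<Rightarrow> 'k" where
  "fold_sum = (SOME f. bij f)"

lemma bij_fold_sum:
  assumes "infinite (UNIV :: 'k set)"
  shows "bij (fold_sum :: 'k + 'k \<Rightarrow> 'k)"
proof -
  have "(card_of ((UNIV :: 'k set) <+> (UNIV :: 'k set)), card_of (UNIV :: 'k set)) \<in> ordIso"
    using assms card_of_Plus_infinite1 card_of_mono1 subset_UNIV by blast
  then have "\<exists>f :: 'k + 'k \<Rightarrow> 'k. bij f"
    using card_of_ordIso UNIV_Plus_UNIV by metis
  then show ?thesis unfolding fold_sum_def by (rule someI_ex)
qed

definition double :: "'k set \<Rightarrow> 'k set" where
  "double I = fold_sum ` (I <+> I)"

text \<open>The block matrix \<open>c(x + \<i>y) = [x, -y; y, x]\<close>.\<close>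

definition c_mat :: "('k \<Rightarrow> 'k \<Rightarrow> 'e \<times> 'e) \<Rightarrow> 'k \<Rightarrow> 'k \<Rightarrow> 'e::real_vector" where
  "c_mat z = (\<lambda>p q. case (inv fold_sum p, inv fold_sum q) of
       (Inl i, Inl j) \<Rightarrow> fst (z i j)
     | (Inl i, Inr j) \<Rightarrow> - snd (z i j)
     | (Inr i, Inl j) \<Rightarrow> snd (z i j)
     | (Inr i, Inr j) \<Rightarrow> fst (z i j))"

definition complexification :: "(nat \<Rightarrow> (nat \<Rightarrow> nat \<Rightarrow> 'v) \<Rightarrow> real)
    \<Rightarrow> ('k set \<Rightarrow> ('k \<Rightarrow> 'k \<Rightarrow> ('v::banach) dual) set)
    \<Rightarrow> 'k set \<Rightarrow> ('k \<Rightarrow> 'k \<Rightarrow> 'v dual \<times> 'v dual) set" where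
  "complexification nV K I =
     {z. (\<lambda>i j. fst (z i j)) \<in> dual_mats nV I \<and> (\<lambda>i j. snd (z i j)) \<in> dual_mats nV I \<and>
         c_mat z \<in> K (double I)}"

end

theory Submission
  imports Defs
begin

text \<open>
  The map \<open>c\<close> is an injective homomorphism, so a dilation \<open>x = \<alpha>\<^sup>* z \<alpha>\<close> in \<open>K\<^sub>c\<close> gives the dilation
  \<open>c(x) = c(\<alpha>)\<^sup>* c(z) c(\<alpha>)\<close> in \<open>K\<close>, and \<open>z\<close> commutes with \<open>\<alpha> \<alpha>\<^sup>*\<close> iff \<open>c(z)\<close> commutes with
  \<open>c(\<alpha>) c(\<alpha>)\<^sup>*\<close>. Conversely, let \<open>c(x) = \<alpha>\<^sup>* y \<alpha>\<close> with \<open>y \<in> K\<close> and a real isometry \<open>\<alpha>\<close>. Then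
  \<open>y = y + \<i>0\<close> lies in \<open>K\<^sub>c\<close>, since \<open>c(y) = y \<oplus> y\<close>. The isometry \<open>u = (1, -\<i>)\<^sup>T / \<surd>2\<close> satisfies
  \<open>c(x) u = u x\<close>, so \<open>\<beta> = \<alpha> u\<close> is an isometry with \<open>x = \<beta>\<^sup>* y \<beta>\<close>. If \<open>x\<close> is maximal, then \<open>y\<close> commutes
  with \<open>\<beta> \<beta>\<^sup>*\<close>, and, being real, with its real part \<open>\<alpha> \<alpha>\<^sup>* / 2\<close>.

  Only entrywise identities between products of two matrices are needed, no associativity. All sums
  converge because they pair a square-summable sequence with a row or column of a bounded matrix.
\<close>

section \<open>Bounded vectors and bounded bilinear forms\<close>

text \<open>Weak square-summability: the finite combinations \<open>\<Sum> a s x s\<close> are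
  bounded by the l^2 norm of \<open>a\<close>. This, rather than summability of the squared norms of
  the entries, is what rows and columns of bounded matrices over an operator space satisfy; for real
  entries the two notions agree.\<close>

definition bounded_vec :: "('k \<Rightarrow> 'e::real_normed_vector) \<Rightarrow> bool" where
  "bounded_vec x \<longleftrightarrow> (\<exists>C\<ge>0. \<forall>S a. finite S \<longrightarrow> norm (\<Sum>s\<in>S. a s *\<^sub>R x s) \<le> C * L2_set a S)"

text \<open>Boundedness as a bilinear map on l^2 x l^2 with real coefficients. It follows from the
  matrix norm bounds both for scalar matrices and for matrices over the dual space, passes to pairs,
  and yields \<open>bounded_vec\<close> for every row and column.\<close>

definition bounded_form :: "('a \<Rightarrow> 'b \<Rightarrow> 'e::real_normed_vector) \<Rightarrow> bool" where
  "bounded_form x \<longleftrightarrow> (\<exists>C\<ge>0. \<forall>S T a b. finite S \<longrightarrow> finite T \<longrightarrow>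
     norm (\<Sum>s\<in>S. \<Sum>t\<in>T. (a s * b t) *\<^sub>R x s t) \<le> C * L2_set a S * L2_set b T)"

text \<open>Testing the bound with \<open>a = x\<close> bounds the l^2 norm of \<open>x\<close>; the
  converse is Cauchy-Schwarz.\<close>

lemma bounded_vec_real_iff:
  fixes x :: "'k \<Rightarrow> real"
  shows "bounded_vec x \<longleftrightarrow> (\<exists>C\<ge>0. \<forall>S. finite S \<longrightarrow> L2_set x S \<le> C)"
proof
  assume "bounded_vec x"
  then obtain C where C: "C \<ge> 0" "\<And>S a. finite S \<Longrightarrow> norm (\<Sum>s\<in>S. a s *\<^sub>R x s) \<le> C * L2_set a S"
    unfolding bounded_vec_def by blast
  have "L2_set x S \<le> C" if "finite S" for S
  proof -
    have "L2_set x S * L2_set x S = (\<Sum>s\<in>S. x s * x s)"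
      unfolding L2_set_def by (simp add: sum_nonneg power2_eq_square)
    also have "\<dots> \<le> C * L2_set x S"
      using C(2)[OF that, of x] by simp
    finally show ?thesis
      using C(1) L2_set_nonneg[of x S] by (cases "L2_set x S = 0") auto
  qed
  then show "\<exists>C\<ge>0. \<forall>S. finite S \<longrightarrow> L2_set x S \<le> C"
    using C(1) by blast
next
  assume "\<exists>C\<ge>0. \<forall>S. finite S \<longrightarrow> L2_set x S \<le> C"
  then obtain C where C: "C \<ge> 0" "\<And>S. finite S \<Longrightarrow> L2_set x S \<le> C" by blast
  have "norm (\<Sum>s\<in>S. a s *\<^sub>R x s) \<le> C * L2_set a S" if "finite S" for S a
  proof -
    have "norm (\<Sum>s\<in>S. a s *\<^sub>R x s) \<le> (\<Sum>s\<in>S. \<bar>a s\<bar> * \<bar>x s\<bar>)"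
      using norm_sum[of "\<lambda>s. a s *\<^sub>R x s" S] by (simp add: abs_mult)
    also have "\<dots> \<le> L2_set a S * L2_set x S" by (rule L2_set_mult_ineq)
    also have "\<dots> \<le> L2_set a S * C" by (intro mult_left_mono C that) simp
    finally show ?thesis by (simp add: mult.commute)
  qed
  then show "bounded_vec x" unfolding bounded_vec_def using C(1) by blast
qed

lemma bounded_vec_square_summable:
  fixes x :: "'k \<Rightarrow> real"
  assumes "bounded_vec x"
  shows "(\<lambda>i. (x i)\<^sup>2) summable_on UNIV"
proof -
  obtain C where C: "C \<ge> 0" "\<And>S. finite S \<Longrightarrow> L2_set x S \<le> C"
    using assms bounded_vec_real_iff by blast
  have "(\<Sum>i\<in>S. (x i)\<^sup>2) \<le> C\<^sup>2" if "finite S" for S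
    using power_mono[OF C(2)[OF that], of 2] by (simp add: L2_set_def sum_nonneg)
  then show ?thesis
    by (intro nonneg_bounded_partial_sums_imp_summable_on[where C = "C\<^sup>2"])
      (auto intro: eventually_finite_subsets_at_top_weakI)
qed

lemma bounded_vec_bounded_linear:
  assumes "bounded_linear h" "bounded_vec x"
  shows "bounded_vec (\<lambda>s. h (x s))"
proof -
  interpret bounded_linear h by fact
  obtain B where B: "B \<ge> 0" "\<And>x. norm (h x) \<le> norm x * B" using nonneg_bounded by blast
  obtain C where C: "C \<ge> 0" "\<And>S a. finite S \<Longrightarrow> norm (\<Sum>s\<in>S. a s *\<^sub>R x s) \<le> C * L2_set a S"
    using assms(2) unfolding bounded_vec_def by blast
  have "norm (\<Sum>s\<in>S. a s *\<^sub>R h (x s)) \<le> (C * B) * L2_set a S" if "finite S" for S a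
  proof -
    have "norm (\<Sum>s\<in>S. a s *\<^sub>R h (x s)) = norm (h (\<Sum>s\<in>S. a s *\<^sub>R x s))"
      by (simp add: sum scaleR)
    also have "\<dots> \<le> norm (\<Sum>s\<in>S. a s *\<^sub>R x s) * B" by (rule B)
    also have "\<dots> \<le> (C * L2_set a S) * B" by (intro mult_right_mono C(2) that B(1))
    finally show ?thesis by (simp add: ac_simps)
  qed
  then show ?thesis unfolding bounded_vec_def using B(1) C(1) by (metis mult_nonneg_nonneg)
qed

lemma bounded_vec_add:
  assumes "bounded_vec x" "bounded_vec y"
  shows "bounded_vec (\<lambda>s. x s + y s)"
proof -
  obtain C where C: "C \<ge> 0" "\<And>S a. finite S \<Longrightarrow> norm (\<Sum>s\<in>S. a s *\<^sub>R x s) \<le> C * L2_set a S"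
    using assms(1) unfolding bounded_vec_def by blast
  obtain D where D: "D \<ge> 0" "\<And>S a. finite S \<Longrightarrow> norm (\<Sum>s\<in>S. a s *\<^sub>R y s) \<le> D * L2_set a S"
    using assms(2) unfolding bounded_vec_def by blast
  have "norm (\<Sum>s\<in>S. a s *\<^sub>R (x s + y s)) \<le> (C + D) * L2_set a S" if "finite S" for S a
  proof -
    have "norm (\<Sum>s\<in>S. a s *\<^sub>R (x s + y s))
        \<le> norm (\<Sum>s\<in>S. a s *\<^sub>R x s) + norm (\<Sum>s\<in>S. a s *\<^sub>R y s)"
      by (simp add: scaleR_add_right sum.distrib norm_triangle_ineq)
    also have "\<dots> \<le> (C + D) * L2_set a S"
      using C(2)[OF that, of a] D(2)[OF that, of a] by (simp add: distrib_right)
    finally show ?thesis .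
  qed
  then show ?thesis unfolding bounded_vec_def using C(1) D(1)
    by (intro exI[of _ "C + D"]) simp
qed

lemma bounded_vec_uminus: "bounded_vec x \<Longrightarrow> bounded_vec (\<lambda>s. - x s)"
  by (rule bounded_vec_bounded_linear[OF bounded_linear_minus[OF bounded_linear_ident]])

lemma bounded_vec_diff: "bounded_vec x \<Longrightarrow> bounded_vec y \<Longrightarrow> bounded_vec (\<lambda>s. x s - y s)"
  using bounded_vec_add[OF _ bounded_vec_uminus, of x y] by simp

section \<open>Unconditional convergence in Banach spaces\<close>

lemma summable_on_Cauchy_criterion:
  fixes f :: "'a \<Rightarrow> 'b::banach"
  assumes "\<And>e. e > 0 \<Longrightarrow>
    \<exists>F0. finite F0 \<and> F0 \<subseteq> A \<and> (\<forall>F. finite F \<longrightarrow> F \<subseteq> A - F0 \<longrightarrow> norm (sum f F) < e)"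
  shows "f summable_on A"
proof -
  have "\<exists>P. eventually P (finite_subsets_at_top A) \<and>
      (\<forall>F F'. P F \<and> P F' \<longrightarrow> dist (sum f F) (sum f F') < e)" if "e > 0" for e
  proof -
    obtain F0 where F0: "finite F0" "F0 \<subseteq> A"
      "\<And>F. finite F \<Longrightarrow> F \<subseteq> A - F0 \<Longrightarrow> norm (sum f F) < e / 2"
      using assms[of "e / 2"] \<open>e > 0\<close> by auto
    define P where "P F \<longleftrightarrow> finite F \<and> F0 \<subseteq> F \<and> F \<subseteq> A" for F
    have "eventually P (finite_subsets_at_top A)"
      unfolding eventually_finite_subsets_at_top P_def using F0 by blast
    \<comment> \<open>The common part over \<open>F0\<close> cancels, leaving two sums over sets
      disjoint from \<open>F0\<close>, each of norm below \<open>e / 2\<close>.\<close>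
    moreover have "dist (sum f F) (sum f F') < e" if "P F" "P F'" for F F'
    proof -
      have *: "sum f G = sum f F0 + sum f (G - F0) \<and> norm (sum f (G - F0)) < e / 2" if "P G" for G
        using that F0(3)[of "G - F0"] sum.subset_diff[of F0 G f]
        unfolding P_def by (auto simp: add.commute)
      have "dist (sum f F) (sum f F') = norm (sum f (F - F0) - sum f (F' - F0))"
        using *[OF that(1)] *[OF that(2)] by (simp add: dist_norm)
      also have "\<dots> < e"
        using *[OF that(1)] *[OF that(2)] norm_triangle_ineq4[of "sum f (F - F0)" "sum f (F' - F0)"]
        by simp
      finally show ?thesis .
    qed
    ultimately show ?thesis by blast
  qed
  then have "cauchy_filter (filtermap (sum f) (finite_subsets_at_top A))"
    by (simp add: cauchy_filter_metric_filtermap)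
  moreover have "complete (UNIV :: 'b set)"
    by (meson Cauchy_convergent UNIV_I complete_def convergent_def)
  ultimately obtain L where "(sum f \<longlongrightarrow> L) (finite_subsets_at_top A)"
    using complete_uniform[where S = UNIV] by (force simp add: filterlim_def)
  then show ?thesis unfolding summable_on_def has_sum_def by blast
qed

text \<open>A finite sum away from \<open>F0\<close> is at most \<open>C\<close> times the l^2 norm
  of \<open>a\<close> there, and this is small because the squares of \<open>a\<close> are summable.
  The terms themselves may fail to be absolutely summable, hence the Cauchy criterion.\<close>

lemma bounded_vec_summable:
  fixes x :: "'k \<Rightarrow> 'e::banach" and a :: "'k \<Rightarrow> real"
  assumes "bounded_vec a" "bounded_vec x"
  shows "(\<lambda>i. a i *\<^sub>R x i) summable_on UNIV"
proof (rule summable_on_Cauchy_criterion)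
  fix e :: real assume "e > 0"
  obtain C where C: "C \<ge> 0" "\<And>S a. finite S \<Longrightarrow> norm (\<Sum>s\<in>S. a s *\<^sub>R x s) \<le> C * L2_set a S"
    using assms(2) unfolding bounded_vec_def by blast
  \<comment> \<open>An l^2 tail below \<open>sqrt d = e / (C + 1)\<close> makes the vector sum
    smaller than \<open>e\<close>; \<open>C + 1\<close> replaces \<open>C\<close> so that
    \<open>C = 0\<close> needs no separate case.\<close>
  define d where "d = (e / (C + 1))\<^sup>2"
  have "d > 0" using \<open>e > 0\<close> C(1) by (simp add: d_def)
  obtain F0 where F0: "finite F0"
    "dist (\<Sum>i\<in>F0. (a i)\<^sup>2) (\<Sum>\<^sub>\<infinity>i. (a i)\<^sup>2) \<le> d / 2"
    using infsum_finite_approximation[OF bounded_vec_square_summable[OF assms(1)], of "d / 2"]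
      \<open>d > 0\<close> by auto
  have "norm (\<Sum>i\<in>F. a i *\<^sub>R x i) < e" if F: "finite F" "F \<subseteq> UNIV - F0" for F
  proof -
    \<comment> \<open>The sum over \<open>F0\<close> already reaches the total up to
      \<open>d / 2\<close>, so a disjoint finite set has less than \<open>d\<close> left.\<close>
    have "(\<Sum>i\<in>F0. (a i)\<^sup>2) + (\<Sum>i\<in>F. (a i)\<^sup>2) = (\<Sum>i\<in>F0 \<union> F. (a i)\<^sup>2)"
      using F F0(1) by (intro sum.union_disjoint[symmetric]) auto
    also have "\<dots> \<le> (\<Sum>\<^sub>\<infinity>i. (a i)\<^sup>2)"
      using F F0(1) bounded_vec_square_summable[OF assms(1)] by (intro finite_sum_le_infsum) auto
    finally have "(\<Sum>i\<in>F. (a i)\<^sup>2) < d"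
      using F0(2) \<open>d > 0\<close> unfolding dist_real_def by linarith
    then have "L2_set a F < e / (C + 1)"
      unfolding L2_set_def d_def using \<open>e > 0\<close> C(1) by (intro real_less_lsqrt) (auto simp: sum_nonneg)
    have "norm (\<Sum>i\<in>F. a i *\<^sub>R x i) \<le> C * L2_set a F" by (rule C(2)[OF F(1)])
    also have "\<dots> \<le> (C + 1) * L2_set a F" by (simp add: distrib_right)
    also have "\<dots> < e" using \<open>L2_set a F < e / (C + 1)\<close> C(1) by (simp add: field_simps)
    finally show ?thesis .
  qed
  then show "\<exists>F0. finite F0 \<and> F0 \<subseteq> UNIV \<and>
      (\<forall>F. finite F \<longrightarrow> F \<subseteq> UNIV - F0 \<longrightarrow> norm (\<Sum>i\<in>F. a i *\<^sub>R x i) < e)"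
    using F0(1) by blast
qed

section \<open>Bounded bilinear forms: closure properties and products with vectors\<close>

lemma bounded_formE:
  assumes "bounded_form x"
  obtains C where "C \<ge> 0" "\<And>S T a b. finite S \<Longrightarrow> finite T \<Longrightarrow>
     norm (\<Sum>s\<in>S. \<Sum>t\<in>T. (a s * b t) *\<^sub>R x s t) \<le> C * L2_set a S * L2_set b T"
  using assms unfolding bounded_form_def by blast

lemma bounded_form_transpose: "bounded_form x \<Longrightarrow> bounded_form (\<lambda>s t. x t s)"
proof (erule bounded_formE)
  fix C assume C: "C \<ge> 0" "\<And>S T a b. finite S \<Longrightarrow> finite T \<Longrightarrow>
     norm (\<Sum>s\<in>S. \<Sum>t\<in>T. (a s * b t) *\<^sub>R x s t) \<le> C * L2_set a S * L2_set b T"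
  have "norm (\<Sum>s\<in>S. \<Sum>t\<in>T. (a s * b t) *\<^sub>R x t s) \<le> C * L2_set a S * L2_set b T"
    if "finite S" "finite T" for S T a b
    using C(2)[OF that(2) that(1), of b a] by (subst sum.swap) (simp add: ac_simps)
  then show ?thesis unfolding bounded_form_def using C(1) by blast
qed

lemma bounded_form_col:
  assumes "bounded_form x"
  shows "bounded_vec (\<lambda>s. x s t)"
proof -
  obtain C where C: "C \<ge> 0" "\<And>S T a b. finite S \<Longrightarrow> finite T \<Longrightarrow>
     norm (\<Sum>s\<in>S. \<Sum>t\<in>T. (a s * b t) *\<^sub>R x s t) \<le> C * L2_set a S * L2_set b T"
    by (rule bounded_formE[OF assms]) blast
  have "norm (\<Sum>s\<in>S. a s *\<^sub>R x s t) \<le> C * L2_set a S" if "finite S" for S a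
    using C(2)[OF that, of "{t}" a "\<lambda>_. 1"] by simp
  then show ?thesis unfolding bounded_vec_def using C(1) by blast
qed

lemma bounded_form_row: "bounded_form x \<Longrightarrow> bounded_vec (x s)"
  using bounded_form_col[of "\<lambda>s t. x t s" s] bounded_form_transpose[of x] by simp

lemma bounded_form_add:
  assumes "bounded_form x" "bounded_form y"
  shows "bounded_form (\<lambda>s t. x s t + y s t)"
proof -
  obtain C where C: "C \<ge> 0" "\<And>S T a b. finite S \<Longrightarrow> finite T \<Longrightarrow>
     norm (\<Sum>s\<in>S. \<Sum>t\<in>T. (a s * b t) *\<^sub>R x s t) \<le> C * L2_set a S * L2_set b T"
    by (rule bounded_formE[OF assms(1)]) blast
  obtain D where D: "D \<ge> 0" "\<And>S T a b. finite S \<Longrightarrow> finite T \<Longrightarrow>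
     norm (\<Sum>s\<in>S. \<Sum>t\<in>T. (a s * b t) *\<^sub>R y s t) \<le> D * L2_set a S * L2_set b T"
    by (rule bounded_formE[OF assms(2)]) blast
  have "norm (\<Sum>s\<in>S. \<Sum>t\<in>T. (a s * b t) *\<^sub>R (x s t + y s t)) \<le> (C + D) * L2_set a S * L2_set b T"
    if "finite S" "finite T" for S T a b
  proof -
    have "norm (\<Sum>s\<in>S. \<Sum>t\<in>T. (a s * b t) *\<^sub>R (x s t + y s t))
      \<le> norm (\<Sum>s\<in>S. \<Sum>t\<in>T. (a s * b t) *\<^sub>R x s t) + norm (\<Sum>s\<in>S. \<Sum>t\<in>T. (a s * b t) *\<^sub>R y s t)"
      by (simp add: scaleR_add_right sum.distrib norm_triangle_ineq)
    also have "\<dots> \<le> (C + D) * L2_set a S * L2_set b T"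
      using C(2)[OF that, of a b] D(2)[OF that, of a b] by (simp add: distrib_right)
    finally show ?thesis .
  qed
  then show ?thesis unfolding bounded_form_def using C(1) D(1)
    by (intro exI[of _ "C + D"]) simp
qed

lemma bounded_form_bounded_linear:
  assumes "bounded_linear h" "bounded_form x"
  shows "bounded_form (\<lambda>s t. h (x s t))"
proof -
  interpret bounded_linear h by fact
  obtain B where B: "B \<ge> 0" "\<And>x. norm (h x) \<le> norm x * B" using nonneg_bounded by blast
  obtain C where C: "C \<ge> 0" "\<And>S T a b. finite S \<Longrightarrow> finite T \<Longrightarrow>
     norm (\<Sum>s\<in>S. \<Sum>t\<in>T. (a s * b t) *\<^sub>R x s t) \<le> C * L2_set a S * L2_set b T"
    by (rule bounded_formE[OF assms(2)]) blast
  have "norm (\<Sum>s\<in>S. \<Sum>t\<in>T. (a s * b t) *\<^sub>R h (x s t)) \<le> (C * B) * L2_set a S * L2_set b T"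
    if "finite S" "finite T" for S T a b
  proof -
    have "norm (\<Sum>s\<in>S. \<Sum>t\<in>T. (a s * b t) *\<^sub>R h (x s t))
        = norm (h (\<Sum>s\<in>S. \<Sum>t\<in>T. (a s * b t) *\<^sub>R x s t))"
      by (simp add: sum scaleR)
    also have "\<dots> \<le> norm (\<Sum>s\<in>S. \<Sum>t\<in>T. (a s * b t) *\<^sub>R x s t) * B" by (rule B)
    also have "\<dots> \<le> (C * L2_set a S * L2_set b T) * B"
      by (intro mult_right_mono C(2) that B(1))
    finally show ?thesis by (simp add: ac_simps)
  qed
  then show ?thesis unfolding bounded_form_def using B(1) C(1)
    by (intro exI[of _ "C * B"]) simp
qed

lemma bounded_form_uminus: "bounded_form x \<Longrightarrow> bounded_form (\<lambda>s t. - x s t)"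
  by (rule bounded_form_bounded_linear[OF bounded_linear_minus[OF bounded_linear_ident]])

text \<open>The coefficients on \<open>A\<close> and \<open>B\<close> are carried along
  \<open>f\<close> and \<open>g\<close>; injectivity keeps their l^2 norms from growing, so the
  constant \<open>C\<close> survives. This extracts blocks, assembles block matrices from
  zero-padded blocks, and bounds coordinate embeddings.\<close>

lemma bounded_form_reindex:
  assumes "bounded_form x" and f: "inj_on f A" and g: "inj_on g B"
  shows "bounded_form (\<lambda>p q. if p \<in> A \<and> q \<in> B then x (f p) (g q) else 0)"
proof -
  obtain C where C: "C \<ge> 0" "\<And>S T a b. finite S \<Longrightarrow> finite T \<Longrightarrow>
     norm (\<Sum>s\<in>S. \<Sum>t\<in>T. (a s * b t) *\<^sub>R x s t) \<le> C * L2_set a S * L2_set b T"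
    by (rule bounded_formE[OF assms(1)]) blast
  have L2: "L2_set (\<lambda>s. a (the_inv_into A f s)) (f ` (S \<inter> A)) \<le> L2_set a S"
    if "finite S" "inj_on f A" for a :: "'z \<Rightarrow> real" and f :: "'z \<Rightarrow> 'y" and S A
  proof -
    have "inj_on f (S \<inter> A)" using that(2) by (rule inj_on_subset) auto
    then have "(\<Sum>s\<in>f ` (S \<inter> A). (a (the_inv_into A f s))\<^sup>2) = (\<Sum>s\<in>S \<inter> A. (a s)\<^sup>2)"
      using that(2) by (simp add: sum.reindex the_inv_into_f_f)
    also have "\<dots> \<le> (\<Sum>s\<in>S. (a s)\<^sup>2)" using that(1) by (intro sum_mono2) auto
    finally show ?thesis by (simp add: L2_set_def)
  qed
  have "norm (\<Sum>p\<in>S. \<Sum>q\<in>T. (a p * b q) *\<^sub>R (if p \<in> A \<and> q \<in> B then x (f p) (g q) else 0))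
     \<le> C * L2_set a S * L2_set b T" if "finite S" "finite T" for S T a b
  proof -
    let ?a = "\<lambda>s. a (the_inv_into A f s)" and ?b = "\<lambda>t. b (the_inv_into B g t)"
    have "(\<Sum>p\<in>S. \<Sum>q\<in>T. (a p * b q) *\<^sub>R (if p \<in> A \<and> q \<in> B then x (f p) (g q) else 0))
        = (\<Sum>p\<in>S \<inter> A. \<Sum>q\<in>T \<inter> B. (a p * b q) *\<^sub>R x (f p) (g q))"
      using that by (intro sum.mono_neutral_cong_right ballI) (auto intro!: sum.neutral sum.mono_neutral_cong_right)
    also have "\<dots> = (\<Sum>s\<in>f ` (S \<inter> A). \<Sum>t\<in>g ` (T \<inter> B). (?a s * ?b t) *\<^sub>R x s t)"
    proof -
      have "inj_on f (S \<inter> A)" "inj_on g (T \<inter> B)" using f g by (auto intro: inj_on_subset)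
      then show ?thesis using f g by (simp add: sum.reindex the_inv_into_f_f)
    qed
    finally have "norm (\<Sum>p\<in>S. \<Sum>q\<in>T. (a p * b q) *\<^sub>R (if p \<in> A \<and> q \<in> B then x (f p) (g q) else 0))
        \<le> C * L2_set ?a (f ` (S \<inter> A)) * L2_set ?b (g ` (T \<inter> B))"
      using C(2)[of "f ` (S \<inter> A)" "g ` (T \<inter> B)" ?a ?b] that by simp
    also have "\<dots> \<le> C * L2_set a S * L2_set b T"
      using L2[OF that(1) f, of a] L2[OF that(2) g, of b] C(1)
      by (intro mult_mono mult_left_mono mult_nonneg_nonneg) auto
    finally show ?thesis .
  qed
  then show ?thesis unfolding bounded_form_def using C(1) by blast
qed

lemma bounded_form_0: "bounded_form (\<lambda>_ _. 0)"
  unfolding bounded_form_def by (auto intro!: exI[of _ 0])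

lemma bounded_form_identity: "bounded_form (\<lambda>s t. if s = t then 1 else 0 :: real)"
proof -
  have "norm (\<Sum>s\<in>S. \<Sum>t\<in>T. (a s * b t) *\<^sub>R (if s = t then 1 else 0 :: real))
      \<le> 1 * L2_set a S * L2_set b T" if "finite S" "finite T" for S T and a b :: "'a \<Rightarrow> real"
  proof -
    have "(\<Sum>s\<in>S. \<Sum>t\<in>T. (a s * b t) *\<^sub>R (if s = t then 1 else 0 :: real)) = (\<Sum>s\<in>S \<inter> T. a s * b s)"
      using that by (simp add: if_distrib sum.inter_restrict cong: if_cong)
    also have "norm \<dots> \<le> (\<Sum>s\<in>S \<inter> T. \<bar>a s\<bar> * \<bar>b s\<bar>)"
      using norm_sum[of "\<lambda>s. a s * b s" "S \<inter> T"] by (simp add: abs_mult)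
    also have "\<dots> \<le> L2_set a (S \<inter> T) * L2_set b (S \<inter> T)" by (rule L2_set_mult_ineq)
    also have "\<dots> \<le> L2_set a S * L2_set b T"
      using that unfolding L2_set_def
      by (intro mult_mono real_sqrt_le_mono sum_mono2) (auto simp: sum_nonneg)
    finally show ?thesis by simp
  qed
  then show ?thesis unfolding bounded_form_def by (intro exI[of _ 1]) simp
qed

text \<open>The partial sums over finite \<open>T\<close> obey the bound with the constant
  \<open>C * D\<close>, uniformly in \<open>T\<close>, and the bound passes to the limit. Thus the
  inner factor \<open>z \<alpha>\<close> of an iterated product can be paired with a further
  row.\<close>

lemma bounded_form_product_col:
  fixes x :: "'a \<Rightarrow> 'b \<Rightarrow> 'e::banach"
  assumes "bounded_form x" "bounded_vec b"
  shows "bounded_vec (\<lambda>s. \<Sum>\<^sub>\<infinity>t. b t *\<^sub>R x s t)"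
proof -
  obtain C where C: "C \<ge> 0" "\<And>S T a b. finite S \<Longrightarrow> finite T \<Longrightarrow>
     norm (\<Sum>s\<in>S. \<Sum>t\<in>T. (a s * b t) *\<^sub>R x s t) \<le> C * L2_set a S * L2_set b T"
    by (rule bounded_formE[OF assms(1)]) blast
  obtain D where D: "D \<ge> 0" "\<And>T. finite T \<Longrightarrow> L2_set b T \<le> D"
    using assms(2) bounded_vec_real_iff by blast
  have "norm (\<Sum>s\<in>S. a s *\<^sub>R (\<Sum>\<^sub>\<infinity>t. b t *\<^sub>R x s t)) \<le> (C * D) * L2_set a S" if "finite S" for S a
  proof -
    have "((\<lambda>t. b t *\<^sub>R x s t) has_sum (\<Sum>\<^sub>\<infinity>t. b t *\<^sub>R x s t)) UNIV" for s
      by (intro has_sum_infsum bounded_vec_summable assms bounded_form_row)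
    then have "((\<lambda>T. \<Sum>s\<in>S. a s *\<^sub>R (\<Sum>t\<in>T. b t *\<^sub>R x s t))
        \<longlongrightarrow> (\<Sum>s\<in>S. a s *\<^sub>R (\<Sum>\<^sub>\<infinity>t. b t *\<^sub>R x s t))) (finite_subsets_at_top UNIV)"
      unfolding has_sum_def by (intro tendsto_intros)
    then show ?thesis
    proof (rule tendsto_upperbound[OF tendsto_norm])
      show "\<forall>\<^sub>F T in finite_subsets_at_top UNIV.
          norm (\<Sum>s\<in>S. a s *\<^sub>R (\<Sum>t\<in>T. b t *\<^sub>R x s t)) \<le> C * D * L2_set a S"
      proof (rule eventually_finite_subsets_at_top_weakI)
        fix T :: "'b set" assume "finite T"
        have "norm (\<Sum>s\<in>S. a s *\<^sub>R (\<Sum>t\<in>T. b t *\<^sub>R x s t)) \<le> C * L2_set a S * L2_set b T"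
          using C(2)[OF \<open>finite S\<close> \<open>finite T\<close>, of a b] by (simp add: scaleR_sum_right)
        also have "\<dots> \<le> C * L2_set a S * D"
          using C(1) D(2)[OF \<open>finite T\<close>] by (intro mult_left_mono) auto
        finally show "norm (\<Sum>s\<in>S. a s *\<^sub>R (\<Sum>t\<in>T. b t *\<^sub>R x s t)) \<le> C * D * L2_set a S"
          by (simp add: ac_simps)
      qed
    qed simp
  qed
  then show ?thesis unfolding bounded_vec_def using C(1) D(1)
    by (intro exI[of _ "C * D"]) simp
qed

section \<open>Operator norm bounds and bilinear bounds\<close>

lemma L2_set_subset: "finite T \<Longrightarrow> S \<subseteq> T \<Longrightarrow> L2_set f S \<le> L2_set f T"
  unfolding L2_set_def by (intro real_sqrt_le_mono sum_mono2) auto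

text \<open>The operator bound is applied to the vector \<open>b\<close>, embedded in the field by
  \<open>of_real\<close>; pairing its image with \<open>a\<close> is Cauchy-Schwarz.\<close>

lemma op_norm_leD:
  assumes "op_norm_le S T \<alpha> C" "finite S" "finite T"
  shows "norm (\<Sum>s\<in>S. \<Sum>t\<in>T. (a s * b t) *\<^sub>R \<alpha> s t) \<le> C * L2_set a S * L2_set b T"
proof -
  define w where "w s = (\<Sum>t\<in>T. \<alpha> s t * of_real (b t))" for s
  have w: "L2_set (\<lambda>s. norm (w s)) S \<le> C * L2_set b T"
    using assms(1) unfolding op_norm_le_def w_def
    by (auto dest: spec[of _ "\<lambda>t. of_real (b t)"] simp: L2_set_def)
  have "(\<Sum>s\<in>S. \<Sum>t\<in>T. (a s * b t) *\<^sub>R \<alpha> s t) = (\<Sum>s\<in>S. a s *\<^sub>R w s)"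
    unfolding w_def by (simp add: scaleR_sum_right scaleR_conv_of_real sum_distrib_left ac_simps)
  also have "norm \<dots> \<le> (\<Sum>s\<in>S. \<bar>a s\<bar> * \<bar>norm (w s)\<bar>)"
    using norm_sum[of "\<lambda>s. a s *\<^sub>R w s" S] by simp
  also have "\<dots> \<le> L2_set a S * L2_set (\<lambda>s. norm (w s)) S" by (rule L2_set_mult_ineq)
  also have "\<dots> \<le> L2_set a S * (C * L2_set b T)" by (intro mult_left_mono w) simp
  finally show ?thesis by (simp add: mult_ac)
qed

lemma bounded_form_scalar_mats:
  assumes "\<alpha> \<in> scalar_mats J I"
  shows "bounded_form \<alpha>"
proof -
  have supp: "\<And>j i. j \<notin> J \<or> i \<notin> I \<Longrightarrow> \<alpha> j i = 0"
    using assms unfolding scalar_mats_def by auto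
  have "\<exists>C. \<forall>S T. finite S \<and> S \<subseteq> J \<and> finite T \<and> T \<subseteq> I \<longrightarrow> op_norm_le S T \<alpha> C"
    using assms unfolding scalar_mats_def by simp
  then obtain C where C: "\<And>S T. finite S \<Longrightarrow> S \<subseteq> J \<Longrightarrow> finite T \<Longrightarrow> T \<subseteq> I \<Longrightarrow> op_norm_le S T \<alpha> C"
    by metis
  have C0: "C \<ge> 0" using C[of "{}" "{}"] by (simp add: op_norm_le_def)
  have "norm (\<Sum>s\<in>S. \<Sum>t\<in>T. (a s * b t) *\<^sub>R \<alpha> s t) \<le> C * L2_set a S * L2_set b T"
    if "finite S" "finite T" for S T a b
  proof -
    have "(\<Sum>s\<in>S. \<Sum>t\<in>T. (a s * b t) *\<^sub>R \<alpha> s t) = (\<Sum>s\<in>S \<inter> J. \<Sum>t\<in>T \<inter> I. (a s * b t) *\<^sub>R \<alpha> s t)"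
      using that supp
      by (intro sum.mono_neutral_cong_right ballI) (auto intro!: sum.neutral sum.mono_neutral_cong_right)
    also have "norm \<dots> \<le> C * L2_set a (S \<inter> J) * L2_set b (T \<inter> I)"
      using that by (intro op_norm_leD C) auto
    also have "\<dots> \<le> C * L2_set a S * L2_set b T"
      using that C0 by (intro mult_mono mult_left_mono L2_set_subset) auto
    finally show ?thesis .
  qed
  then show ?thesis unfolding bounded_form_def using C0 by blast
qed

text \<open>Duality: with the image vector \<open>w\<close> itself as left coefficients, the form
  bound reads \<open>|w|^2 \<le> C |w| |b|\<close>, and one factor \<open>|w|\<close>
  cancels.\<close>

lemma bounded_form_real_L2:
  fixes x :: "'a \<Rightarrow> 'b \<Rightarrow> real"
  assumes "bounded_form x"
  obtains C where "C \<ge> 0" "\<And>S T b. finite S \<Longrightarrow> finite T \<Longrightarrow>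
    L2_set (\<lambda>s. \<Sum>t\<in>T. x s t * b t) S \<le> C * L2_set b T"
proof -
  obtain C where C: "C \<ge> 0" "\<And>S T a b. finite S \<Longrightarrow> finite T \<Longrightarrow>
     norm (\<Sum>s\<in>S. \<Sum>t\<in>T. (a s * b t) *\<^sub>R x s t) \<le> C * L2_set a S * L2_set b T"
    by (rule bounded_formE[OF assms]) blast
  have "L2_set (\<lambda>s. \<Sum>t\<in>T. x s t * b t) S \<le> C * L2_set b T" if "finite S" "finite T" for S T b
  proof -
    define w where "w s = (\<Sum>t\<in>T. x s t * b t)" for s
    have "L2_set w S * L2_set w S = (\<Sum>s\<in>S. w s * w s)"
      unfolding L2_set_def by (simp add: sum_nonneg power2_eq_square)
    also have "\<dots> = (\<Sum>s\<in>S. \<Sum>t\<in>T. (w s * b t) *\<^sub>R x s t)"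
      by (intro sum.cong refl) (subst (2) w_def, simp add: sum_distrib_left mult_ac)
    also have "\<dots> \<le> C * L2_set w S * L2_set b T" using C(2)[OF that, of w b] by simp
    finally have "L2_set w S * L2_set w S \<le> L2_set w S * (C * L2_set b T)" by (simp add: mult_ac)
    then have "L2_set w S \<le> C * L2_set b T"
      using C(1) L2_set_nonneg[of w S] by (cases "L2_set w S = 0") auto
    then show ?thesis unfolding w_def .
  qed
  then show ?thesis using that C(1) by blast
qed

lemma scalar_mats_realI:
  fixes \<alpha> :: "'k \<Rightarrow> 'k \<Rightarrow> real"
  assumes "bounded_form \<alpha>" "\<And>j i. \<alpha> j i \<noteq> 0 \<Longrightarrow> j \<in> J \<and> i \<in> I"
  shows "\<alpha> \<in> scalar_mats J I"
proof -
  obtain C where "C \<ge> 0" "\<And>S T b. finite S \<Longrightarrow> finite T \<Longrightarrow>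
    L2_set (\<lambda>s. \<Sum>t\<in>T. \<alpha> s t * b t) S \<le> C * L2_set b T"
    by (rule bounded_form_real_L2[OF assms(1)]) blast
  then have "op_norm_le S T \<alpha> C" if "finite S" "finite T" for S T
    using that by (simp add: op_norm_le_def L2_set_def)
  then show ?thesis unfolding scalar_mats_def using assms(2) by blast
qed

text \<open>The real and the imaginary part of the image each combine one product with
  \<open>Re \<alpha>\<close> and one with \<open>Im \<alpha>\<close>; bounding a complex modulus by
  the sum of both parts gives the constant \<open>2 * (C + D)\<close>.\<close>

lemma scalar_mats_complexI:
  fixes \<alpha> :: "'k \<Rightarrow> 'k \<Rightarrow> complex"
  assumes "bounded_form (\<lambda>j i. Re (\<alpha> j i))" "bounded_form (\<lambda>j i. Im (\<alpha> j i))"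
    and "\<And>j i. \<alpha> j i \<noteq> 0 \<Longrightarrow> j \<in> J \<and> i \<in> I"
  shows "\<alpha> \<in> scalar_mats J I"
proof -
  obtain C where C: "C \<ge> 0" "\<And>S T b. finite S \<Longrightarrow> finite T \<Longrightarrow>
    L2_set (\<lambda>s. \<Sum>t\<in>T. Re (\<alpha> s t) * b t) S \<le> C * L2_set b T"
    by (rule bounded_form_real_L2[OF assms(1)]) blast
  obtain D where D: "D \<ge> 0" "\<And>S T b. finite S \<Longrightarrow> finite T \<Longrightarrow>
    L2_set (\<lambda>s. \<Sum>t\<in>T. Im (\<alpha> s t) * b t) S \<le> D * L2_set b T"
    by (rule bounded_form_real_L2[OF assms(2)]) blast
  have "L2_set (\<lambda>s. norm (\<Sum>t\<in>T. \<alpha> s t * \<xi> t)) S \<le> 2 * (C + D) * L2_set (\<lambda>t. norm (\<xi> t)) T"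
    if "finite S" "finite T" for S T \<xi>
  proof -
    let ?A = "\<lambda>b s. \<Sum>t\<in>T. Re (\<alpha> s t) * b t" and ?B = "\<lambda>b s. \<Sum>t\<in>T. Im (\<alpha> s t) * b t"
    let ?R = "\<lambda>t. Re (\<xi> t)" and ?I = "\<lambda>t. Im (\<xi> t)"
    have le: "L2_set b T \<le> L2_set (\<lambda>t. norm (\<xi> t)) T" if "\<And>t. \<bar>b t\<bar> \<le> norm (\<xi> t)" for b
      unfolding L2_set_def using that
      by (intro real_sqrt_le_mono sum_mono) (metis abs_ge_zero power2_abs power_mono)
    have "norm (\<Sum>t\<in>T. \<alpha> s t * \<xi> t) \<le> (\<bar>?A ?R s\<bar> + \<bar>?B ?I s\<bar>) + (\<bar>?A ?I s\<bar> + \<bar>?B ?R s\<bar>)" for s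
      using cmod_le[of "\<Sum>t\<in>T. \<alpha> s t * \<xi> t"] by (simp add: sum_subtractf sum.distrib)
    then have "L2_set (\<lambda>s. norm (\<Sum>t\<in>T. \<alpha> s t * \<xi> t)) S
        \<le> L2_set (\<lambda>s. (\<bar>?A ?R s\<bar> + \<bar>?B ?I s\<bar>) + (\<bar>?A ?I s\<bar> + \<bar>?B ?R s\<bar>)) S"
      by (intro L2_set_mono) auto
    also have "\<dots> \<le> (L2_set (\<lambda>s. \<bar>?A ?R s\<bar>) S + L2_set (\<lambda>s. \<bar>?B ?I s\<bar>) S)
        + (L2_set (\<lambda>s. \<bar>?A ?I s\<bar>) S + L2_set (\<lambda>s. \<bar>?B ?R s\<bar>) S)"
      by (rule order_trans[OF L2_set_triangle_ineq add_mono]; rule L2_set_triangle_ineq)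
    also have "\<dots> = (L2_set (?A ?R) S + L2_set (?B ?I) S) + (L2_set (?A ?I) S + L2_set (?B ?R) S)"
      by (simp add: L2_set_def)
    also have "\<dots> \<le> (C * L2_set ?R T + D * L2_set ?I T) + (C * L2_set ?I T + D * L2_set ?R T)"
      by (intro add_mono C(2) D(2) that)
    also have "\<dots> \<le> (C * L2_set (\<lambda>t. norm (\<xi> t)) T + D * L2_set (\<lambda>t. norm (\<xi> t)) T)
        + (C * L2_set (\<lambda>t. norm (\<xi> t)) T + D * L2_set (\<lambda>t. norm (\<xi> t)) T)"
      using C(1) D(1) by (intro add_mono mult_left_mono le) (auto simp: abs_Re_le_cmod abs_Im_le_cmod)
    finally show ?thesis by (simp add: algebra_simps)
  qed
  then have "op_norm_le S T \<alpha> (2 * (C + D))" if "finite S" "finite T" for S T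
    using that C(1) D(1) by (simp add: op_norm_le_def)
  then show ?thesis unfolding scalar_mats_def using assms(3) by blast
qed

text \<open>Testing the 1 x 1 amplification on a fixed \<open>v\<close> turns \<open>x\<close> into
  a scalar matrix of norm at most \<open>C * norm v\<close>; letting \<open>v\<close> vary recovers
  the norm in the dual space.\<close>

lemma bounded_form_dual_mats:
  fixes nV :: "nat \<Rightarrow> (nat \<Rightarrow> nat \<Rightarrow> 'v::banach) \<Rightarrow> real" and x :: "'k \<Rightarrow> 'k \<Rightarrow> 'v dual"
  assumes nV: "real_operator_space nV" and x: "x \<in> dual_mats nV I"
  shows "bounded_form x"
proof -
  have supp: "\<And>j i. j \<notin> I \<or> i \<notin> I \<Longrightarrow> x j i = 0"
    using x unfolding dual_mats_def by auto
  have "\<exists>C. \<forall>S. finite S \<and> S \<subseteq> I \<longrightarrow> dual_norm_le nV S x C"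
    using x unfolding dual_mats_def by simp
  then obtain C where C: "\<And>S. finite S \<Longrightarrow> S \<subseteq> I \<Longrightarrow> dual_norm_le nV S x C"
    by metis
  have C0: "C \<ge> 0" using C[of "{}"] by (simp add: dual_norm_le_def)
  have n1: "nV 1 (\<lambda>i j. v) = norm v" for v
    using nV unfolding real_operator_space_def by blast
  have "norm (\<Sum>s\<in>S. \<Sum>t\<in>T. (a s * b t) *\<^sub>R x s t) \<le> C * L2_set a S * L2_set b T"
    if fin: "finite S" "finite T" for S T a b
  proof (rule norm_blinfun_bound)
    show "0 \<le> C * L2_set a S * L2_set b T" using C0 by simp
    fix v
    \<comment> \<open>\<open>dual_norm_le\<close> speaks of square blocks inside \<open>I\<close>.
      Rows \<open>S\<close> and columns \<open>T\<close> are therefore merged into one index set,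
      with the coefficients extended by zero.\<close>
    define U where "U = (S \<union> T) \<inter> I"
    define a' where "a' s = (if s \<in> S then a s else 0)" for s
    define b' where "b' t = (if t \<in> T then b t else 0)" for t
    have U: "finite U" "U \<subseteq> I" using fin by (auto simp: U_def)
    have op: "op_norm_le (U \<times> {..<1::nat}) (U \<times> {..<1::nat})
        (\<lambda>(i, p) (j, q). blinfun_apply (x i j) v) (C * norm v)"
      using C[OF U] unfolding dual_norm_le_def n1[symmetric]
      by (auto dest!: spec[of _ "1::nat"] spec[of _ "\<lambda>_ _. v"])
    \<comment> \<open>For \<open>n = 1\<close> the amplified index set is just a copy of
      \<open>U\<close>.\<close>
    have U1: "U \<times> {..<1::nat} = (\<lambda>u. (u, 0)) ` U" by auto
    have inj: "inj_on (\<lambda>u. (u, 0::nat)) U" by (auto intro: inj_onI)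
    have L2: "L2_set (\<lambda>s. f (fst s)) (U \<times> {..<1::nat}) = L2_set f U" for f
      unfolding L2_set_def U1 by (simp add: sum.reindex[OF inj])
    have "blinfun_apply (\<Sum>s\<in>S. \<Sum>t\<in>T. (a s * b t) *\<^sub>R x s t) v
        = (\<Sum>s\<in>S. \<Sum>t\<in>T. (a s * b t) *\<^sub>R blinfun_apply (x s t) v)"
      by (simp add: blinfun.sum_left blinfun.scaleR_left)
    also have "\<dots> = (\<Sum>s\<in>U. \<Sum>t\<in>U. (a' s * b' t) *\<^sub>R blinfun_apply (x s t) v)"
    proof -
      have "(\<Sum>s\<in>S. \<Sum>t\<in>T. (a s * b t) *\<^sub>R blinfun_apply (x s t) v)
          = (\<Sum>s\<in>S \<inter> I. \<Sum>t\<in>T \<inter> I. (a s * b t) *\<^sub>R blinfun_apply (x s t) v)"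
        using fin supp
        by (intro sum.mono_neutral_cong_right ballI) (auto intro!: sum.neutral sum.mono_neutral_cong_right)
      also have "\<dots> = (\<Sum>s\<in>U. \<Sum>t\<in>U. (a' s * b' t) *\<^sub>R blinfun_apply (x s t) v)"
        using U(1) unfolding U_def a'_def b'_def
        by (intro sum.mono_neutral_cong_left ballI) (auto intro!: sum.neutral sum.mono_neutral_cong_left)
      finally show ?thesis .
    qed
    also have "\<dots> = (\<Sum>s\<in>U \<times> {..<1::nat}. \<Sum>t\<in>U \<times> {..<1::nat}. (a' (fst s) * b' (fst t)) *\<^sub>R
        (\<lambda>(i, p) (j, q). blinfun_apply (x i j) v) s t)"
      unfolding U1 by (simp add: sum.reindex[OF inj])
    also have "norm \<dots> \<le> (C * norm v) * L2_set (\<lambda>s. a' (fst s)) (U \<times> {..<1::nat})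
        * L2_set (\<lambda>s. b' (fst s)) (U \<times> {..<1::nat})"
      using U by (intro op_norm_leD op) auto
    also have "\<dots> = (C * norm v) * L2_set a' U * L2_set b' U" unfolding L2 ..
    also have "\<dots> \<le> (C * norm v) * L2_set a S * L2_set b T"
    proof -
      have "(\<Sum>s\<in>U. (a' s)\<^sup>2) \<le> (\<Sum>s\<in>S. (a s)\<^sup>2)" "(\<Sum>s\<in>U. (b' s)\<^sup>2) \<le> (\<Sum>s\<in>T. (b s)\<^sup>2)"
      proof -
        have "(\<Sum>s\<in>U. (a' s)\<^sup>2) = (\<Sum>s\<in>S \<inter> I. (a s)\<^sup>2)"
          using U(1) unfolding U_def a'_def by (intro sum.mono_neutral_cong_right) auto
        then show "(\<Sum>s\<in>U. (a' s)\<^sup>2) \<le> (\<Sum>s\<in>S. (a s)\<^sup>2)"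
          using fin sum_mono2[of S "S \<inter> I" "\<lambda>s. (a s)\<^sup>2"] by auto
        have "(\<Sum>s\<in>U. (b' s)\<^sup>2) = (\<Sum>s\<in>T \<inter> I. (b s)\<^sup>2)"
          using U(1) unfolding U_def b'_def by (intro sum.mono_neutral_cong_right) auto
        then show "(\<Sum>s\<in>U. (b' s)\<^sup>2) \<le> (\<Sum>s\<in>T. (b s)\<^sup>2)"
          using fin sum_mono2[of T "T \<inter> I" "\<lambda>s. (b s)\<^sup>2"] by auto
      qed
      then show ?thesis using C0
        by (intro mult_mono mult_left_mono) (auto simp: L2_set_def sum_nonneg)
    qed
    finally show "norm (blinfun_apply (\<Sum>s\<in>S. \<Sum>t\<in>T. (a s * b t) *\<^sub>R x s t) v)
        \<le> C * L2_set a S * L2_set b T * norm v" by (simp add: mult_ac)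
  qed
  then show ?thesis unfolding bounded_form_def using C0 by blast
qed

section \<open>Sums of pairs\<close>

lemma bounded_vec_Pair:
  assumes "bounded_vec a" "bounded_vec b"
  shows "bounded_vec (\<lambda>s. (a s, b s))"
proof -
  have "bounded_vec (\<lambda>s. (a s, 0) + (0, b s))"
    by (intro bounded_vec_add bounded_vec_bounded_linear[OF _ assms(1)]
        bounded_vec_bounded_linear[OF _ assms(2)]) (intro bounded_linear_intros)+
  then show ?thesis by simp
qed

lemma bounded_form_Pair:
  assumes "bounded_form a" "bounded_form b"
  shows "bounded_form (\<lambda>s t. (a s t, b s t))"
proof -
  have "bounded_form (\<lambda>s t. (a s t, 0) + (0, b s t))"
    by (intro bounded_form_add bounded_form_bounded_linear[OF _ assms(1)]
        bounded_form_bounded_linear[OF _ assms(2)]) (intro bounded_linear_intros)+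
  then show ?thesis by simp
qed

lemma has_sum_Pair:
  fixes f :: "'a \<Rightarrow> 'b::real_normed_vector" and g :: "'a \<Rightarrow> 'c::real_normed_vector"
  assumes "(f has_sum a) A" "(g has_sum b) A"
  shows "((\<lambda>x. (f x, g x)) has_sum (a, b)) A"
proof -
  have "sum (\<lambda>x. (f x, g x)) = (\<lambda>F. (sum f F, sum g F))" by (rule ext) (rule sum_prod)
  then show ?thesis
    using tendsto_Pair[OF assms[unfolded has_sum_def]] unfolding has_sum_def by simp
qed

lemma has_sum_Complex:
  assumes "(f has_sum a) A" "(g has_sum b) A"
  shows "((\<lambda>x. Complex (f x) (g x)) has_sum Complex a b) A"
proof -
  have "sum (\<lambda>x. Complex (f x) (g x)) = (\<lambda>F. Complex (sum f F) (sum g F))"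
    by (simp add: fun_eq_iff complex_eq_iff)
  then show ?thesis
    using tendsto_Complex[OF assms[unfolded has_sum_def]] unfolding has_sum_def by simp
qed

lemma has_sum_diff:
  fixes f g :: "'a \<Rightarrow> 'b::real_normed_vector"
  assumes "(f has_sum a) A" "(g has_sum b) A"
  shows "((\<lambda>x. f x - g x) has_sum (a - b)) A"
  using has_sum_add[OF assms(1), of "\<lambda>x. - g x" "- b"] assms(2) by (simp add: has_sum_uminus)

lemmas bounded_vec_Re = bounded_vec_bounded_linear[OF bounded_linear_Re]
lemmas bounded_vec_Im = bounded_vec_bounded_linear[OF bounded_linear_Im]
lemmas bounded_vec_fst = bounded_vec_bounded_linear[OF bounded_linear_fst]
lemmas bounded_vec_snd = bounded_vec_bounded_linear[OF bounded_linear_snd]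
lemmas bounded_form_Re = bounded_form_bounded_linear[OF bounded_linear_Re]
lemmas bounded_form_Im = bounded_form_bounded_linear[OF bounded_linear_Im]
lemmas bounded_form_fst = bounded_form_bounded_linear[OF bounded_linear_fst]
lemmas bounded_form_snd = bounded_form_bounded_linear[OF bounded_linear_snd]

section \<open>Complex products in real coordinates\<close>

lemma infsum_scaleC_pair:
  fixes a :: "'k \<Rightarrow> complex" and w :: "'k \<Rightarrow> 'e::banach \<times> 'e"
  assumes "bounded_vec a" "bounded_vec w"
  shows "(\<Sum>\<^sub>\<infinity>k. scaleC_pair (a k) (w k)) =
    ((\<Sum>\<^sub>\<infinity>k. Re (a k) *\<^sub>R fst (w k)) - (\<Sum>\<^sub>\<infinity>k. Im (a k) *\<^sub>R snd (w k)),
     (\<Sum>\<^sub>\<infinity>k. Re (a k) *\<^sub>R snd (w k)) + (\<Sum>\<^sub>\<infinity>k. Im (a k) *\<^sub>R fst (w k)))"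
  unfolding scaleC_pair_def using assms
  by (intro infsumI has_sum_Pair has_sum_diff has_sum_add has_sum_infsum bounded_vec_summable
      bounded_vec_Re bounded_vec_Im bounded_vec_fst bounded_vec_snd)

text \<open>Regards the complex numbers as the complexification of the reals, so that
  \<open>scaleC_pair\<close> and \<open>c_mat\<close> serve scalar matrices too: the block matrix
  c(\<alpha>) is \<open>c_mat (cpair \<alpha>)\<close>.\<close>

definition cpair :: "('k \<Rightarrow> 'k \<Rightarrow> complex) \<Rightarrow> 'k \<Rightarrow> 'k \<Rightarrow> real \<times> real" where
  "cpair \<alpha> = (\<lambda>i j. (Re (\<alpha> i j), Im (\<alpha> i j)))"

lemma bounded_form_cpair: "bounded_form \<alpha> \<Longrightarrow> bounded_form (cpair \<alpha>)"
  unfolding cpair_def by (intro bounded_form_Pair bounded_form_Re bounded_form_Im)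

lemma infsum_complex_mult:
  fixes a b :: "'k \<Rightarrow> complex"
  assumes "bounded_vec a" "bounded_vec b"
  shows "(\<Sum>\<^sub>\<infinity>k. a k * b k) =
    Complex ((\<Sum>\<^sub>\<infinity>k. Re (a k) *\<^sub>R Re (b k)) - (\<Sum>\<^sub>\<infinity>k. Im (a k) *\<^sub>R Im (b k)))
     ((\<Sum>\<^sub>\<infinity>k. Re (a k) *\<^sub>R Im (b k)) + (\<Sum>\<^sub>\<infinity>k. Im (a k) *\<^sub>R Re (b k)))"
proof (rule infsumI)
  have "((\<lambda>k. Complex (Re (a k) *\<^sub>R Re (b k) - Im (a k) *\<^sub>R Im (b k)) (Re (a k) *\<^sub>R Im (b k) + Im (a k) *\<^sub>R Re (b k)))
    has_sum Complex ((\<Sum>\<^sub>\<infinity>k. Re (a k) *\<^sub>R Re (b k)) - (\<Sum>\<^sub>\<infinity>k. Im (a k) *\<^sub>R Im (b k)))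
     ((\<Sum>\<^sub>\<infinity>k. Re (a k) *\<^sub>R Im (b k)) + (\<Sum>\<^sub>\<infinity>k. Im (a k) *\<^sub>R Re (b k)))) UNIV"
    using assms
    by (intro has_sum_Complex has_sum_diff has_sum_add has_sum_infsum bounded_vec_summable
      bounded_vec_Re bounded_vec_Im)
  moreover have "Complex (Re (a k) *\<^sub>R Re (b k) - Im (a k) *\<^sub>R Im (b k))
      (Re (a k) *\<^sub>R Im (b k) + Im (a k) *\<^sub>R Re (b k)) = a k * b k" for k
    by (simp add: complex_eq_iff)
  ultimately show "((\<lambda>k. a k * b k) has_sum Complex ((\<Sum>\<^sub>\<infinity>k. Re (a k) *\<^sub>R Re (b k)) - (\<Sum>\<^sub>\<infinity>k. Im (a k) *\<^sub>R Im (b k)))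
     ((\<Sum>\<^sub>\<infinity>k. Re (a k) *\<^sub>R Im (b k)) + (\<Sum>\<^sub>\<infinity>k. Im (a k) *\<^sub>R Re (b k)))) UNIV"
    by simp
qed

text \<open>Complex multiplication is \<open>scaleC_pair\<close> over the reals. The
  multiplicativity of c, proved for matrices over a Banach space, thereby covers products of scalar
  matrices.\<close>

lemma cpair_lmul:
  assumes "\<And>p. bounded_vec (\<alpha> p)" "\<And>q. bounded_vec (\<lambda>k. \<beta> k q)"
  shows "cpair (lmul (*) \<alpha> \<beta>) = lmul scaleC_pair \<alpha> (cpair \<beta>)"
proof (intro ext)
  fix p q
  have "bounded_vec (\<lambda>k. cpair \<beta> k q)"
    unfolding cpair_def using assms by (intro bounded_vec_Pair bounded_vec_Re bounded_vec_Im)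
  then show "cpair (lmul (*) \<alpha> \<beta>) p q = lmul scaleC_pair \<alpha> (cpair \<beta>) p q"
    using assms by (simp add: lmul_def infsum_scaleC_pair infsum_complex_mult) (simp add: cpair_def infsum_complex_mult assms)
qed

lemma bounded_vec_rmul_scaleC_pair:
  fixes z :: "'k \<Rightarrow> 'k \<Rightarrow> 'e::banach \<times> 'e"
  assumes "bounded_form z" "bounded_vec (\<lambda>l. \<alpha> l q)"
  shows "bounded_vec (\<lambda>k. rmul scaleC_pair z \<alpha> k q)"
proof -
  have "bounded_vec (\<lambda>k. ((\<Sum>\<^sub>\<infinity>l. Re (\<alpha> l q) *\<^sub>R fst (z k l)) - (\<Sum>\<^sub>\<infinity>l. Im (\<alpha> l q) *\<^sub>R snd (z k l)),
     (\<Sum>\<^sub>\<infinity>l. Re (\<alpha> l q) *\<^sub>R snd (z k l)) + (\<Sum>\<^sub>\<infinity>l. Im (\<alpha> l q) *\<^sub>R fst (z k l))))"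
    using assms
    by (intro bounded_vec_Pair bounded_vec_add bounded_vec_diff bounded_form_product_col
        bounded_form_fst bounded_form_snd bounded_vec_Re bounded_vec_Im)
  then show ?thesis
    unfolding rmul_def using assms by (simp add: infsum_scaleC_pair bounded_form_row)
qed

text \<open>Both products let the scalar act in the same way, so a left product is the right product
  of the transposes.\<close>

lemma bounded_vec_lmul_scaleC_pair:
  fixes z :: "'k \<Rightarrow> 'k \<Rightarrow> 'e::banach \<times> 'e"
  assumes "bounded_form z" "bounded_vec (\<alpha> p)"
  shows "bounded_vec (lmul scaleC_pair \<alpha> z p)"
  using bounded_vec_rmul_scaleC_pair[OF bounded_form_transpose[OF assms(1)], of "\<lambda>l q. \<alpha> q l" p] assms(2)
  unfolding lmul_def rmul_def by simp

section \<open>The block matrix map\<close>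

lemma bounded_vec_complexI:
  assumes "bounded_vec (\<lambda>k. Re (a k))" "bounded_vec (\<lambda>k. Im (a k))"
  shows "bounded_vec a"
proof -
  have "bounded_vec (\<lambda>k. of_real (Re (a k)) + \<i> * of_real (Im (a k)))"
    by (intro bounded_vec_add bounded_vec_bounded_linear[OF _ assms(1)]
        bounded_vec_bounded_linear[OF _ assms(2)]) (intro bounded_linear_intros bounded_linear_of_real)+
  then show ?thesis by (simp flip: complex_eq)
qed

lemma bounded_form_adj_complex: "bounded_form \<alpha> \<Longrightarrow> bounded_form (adj \<alpha> :: 'k \<Rightarrow> 'k \<Rightarrow> complex)"
  unfolding adj_def conjugate_complex_def
  by (rule bounded_form_bounded_linear[OF bounded_linear_cnj]) (rule bounded_form_transpose)

lemma lmul_mult_real: "lmul (*) \<alpha> \<beta> = lmul scaleR \<alpha> (\<beta> :: 'k \<Rightarrow> 'k \<Rightarrow> real)"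
  by (simp add: lmul_def)

text \<open>These bounds make the products of \<open>z\<close> with
  \<open>\<alpha> \<alpha>^*\<close> converge, from either side.\<close>

lemma bounded_vec_product_adj:
  fixes \<alpha> :: "'k \<Rightarrow> 'k \<Rightarrow> complex"
  assumes "bounded_form \<alpha>"
  shows "bounded_vec (lmul (*) \<alpha> (adj \<alpha>) p)" "bounded_vec (\<lambda>k. lmul (*) \<alpha> (adj \<alpha>) k q)"
proof -
  let ?P = "lmul (*) \<alpha> (adj \<alpha>)"
  have adj: "bounded_form (adj \<alpha>)" by (rule bounded_form_adj_complex[OF assms])
  have P: "cpair ?P = lmul scaleC_pair \<alpha> (cpair (adj \<alpha>))"
    by (intro cpair_lmul bounded_form_row[OF assms] bounded_form_col[OF adj])
  \<comment> \<open>Commutativity of the complex numbers lets the same matrix be read as a left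
    product, which bounds its rows, and as a right product, which bounds its columns.\<close>
  also have "\<dots> = rmul scaleC_pair (cpair \<alpha>) (adj \<alpha>)"
    by (simp add: lmul_def rmul_def cpair_def scaleC_pair_def mult.commute add.commute)
  finally have P': "cpair ?P = rmul scaleC_pair (cpair \<alpha>) (adj \<alpha>)" .
  have *: "bounded_vec a" if "bounded_vec (\<lambda>k. (Re (a k), Im (a k)))" for a :: "'k \<Rightarrow> complex"
    using bounded_vec_fst[OF that] bounded_vec_snd[OF that] by (intro bounded_vec_complexI) auto
  have "bounded_vec (cpair ?P p)"
    unfolding P by (intro bounded_vec_lmul_scaleC_pair bounded_form_cpair adj bounded_form_row assms)
  then show "bounded_vec (?P p)" unfolding cpair_def by (rule *)
  have "bounded_vec (\<lambda>k. cpair ?P k q)"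
    unfolding P' by (intro bounded_vec_rmul_scaleC_pair bounded_form_cpair bounded_form_col assms adj)
  then show "bounded_vec (\<lambda>k. ?P k q)" unfolding cpair_def by (rule *)
qed

abbreviation "inl i \<equiv> fold_sum (Inl i)"
abbreviation "inr i \<equiv> fold_sum (Inr i)"

context
  assumes inf: "infinite (UNIV :: 'k set)"
begin

lemma fold_sum_eq_iff: "fold_sum s = (fold_sum t :: 'k) \<longleftrightarrow> s = t"
  using bij_fold_sum[OF inf] by (simp add: bij_def inj_eq)

lemma inv_fold_sum: "inv fold_sum (fold_sum s :: 'k) = s"
  using bij_fold_sum[OF inf] by (simp add: bij_def)

lemma fold_sum_cases:
  fixes p :: 'k
  obtains (inl) i where "p = inl i" | (inr) i where "p = inr i"
  using bij_fold_sum[OF inf] by (metis bij_pointE sum.exhaust)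

lemma inl_mem_double: "inl i \<in> double I \<longleftrightarrow> i \<in> (I :: 'k set)"
  by (auto simp: double_def fold_sum_eq_iff)

lemma inr_mem_double: "inr i \<in> double I \<longleftrightarrow> i \<in> (I :: 'k set)"
  by (auto simp: double_def fold_sum_eq_iff)

lemma c_mat_simps:
  fixes i j :: 'k
  shows "c_mat z (inl i) (inl j) = fst (z i j)" "c_mat z (inl i) (inr j) = - snd (z i j)"
    "c_mat z (inr i) (inl j) = snd (z i j)" "c_mat z (inr i) (inr j) = fst (z i j)"
  by (simp_all add: c_mat_def inv_fold_sum)

lemmas block_simps = fold_sum_eq_iff inl_mem_double inr_mem_double c_mat_simps

lemma block_eqI:
  fixes A B :: "'k \<Rightarrow> 'k \<Rightarrow> 'e"
  assumes "\<And>i j. A (inl i) (inl j) = B (inl i) (inl j)" "\<And>i j. A (inl i) (inr j) = B (inl i) (inr j)"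
    "\<And>i j. A (inr i) (inl j) = B (inr i) (inl j)" "\<And>i j. A (inr i) (inr j) = B (inr i) (inr j)"
  shows "A = B"
proof (intro ext)
  fix p q :: 'k show "A p q = B p q"
    by (cases p rule: fold_sum_cases; cases q rule: fold_sum_cases) (simp_all add: assms)
qed

text \<open>The first block column of c(z) displays both components of \<open>z\<close>. This pulls
  identities between block matrices back through c.\<close>

lemma c_mat_inject: "c_mat z = c_mat w \<longleftrightarrow> z = (w :: 'k \<Rightarrow> 'k \<Rightarrow> _)"
proof
  assume *: "c_mat z = c_mat w"
  show "z = w"
  proof (intro ext prod_eqI)
    fix i j
    show "fst (z i j) = fst (w i j)" using fun_cong[OF fun_cong[OF *], of "inl i" "inl j"] by (simp add: c_mat_simps)
    show "snd (z i j) = snd (w i j)" using fun_cong[OF fun_cong[OF *], of "inr i" "inl j"] by (simp add: c_mat_simps)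
  qed
qed simp

section \<open>Block multiplication: c as a homomorphism\<close>

lemma infsum_double:
  fixes g :: "'k \<Rightarrow> 'e::real_normed_vector"
  assumes "(\<lambda>i. g (inl i)) summable_on UNIV" "(\<lambda>i. g (inr i)) summable_on UNIV"
  shows "(\<Sum>\<^sub>\<infinity>k. g k) = (\<Sum>\<^sub>\<infinity>i. g (inl i)) + (\<Sum>\<^sub>\<infinity>i. g (inr i))"
proof (rule infsumI)
  have inj: "inj (\<lambda>i. inl i :: 'k)" "inj (\<lambda>i. inr i :: 'k)" by (auto intro!: injI simp: fold_sum_eq_iff)
  have "(g has_sum (\<Sum>\<^sub>\<infinity>i. g (inl i))) (range (\<lambda>i. inl i))"
    using assms(1) by (simp add: has_sum_reindex[OF inj(1)] o_def)
  moreover have "(g has_sum (\<Sum>\<^sub>\<infinity>i. g (inr i))) (range (\<lambda>i. inr i))"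
    using assms(2) by (simp add: has_sum_reindex[OF inj(2)] o_def)
  ultimately have "(g has_sum (\<Sum>\<^sub>\<infinity>i. g (inl i)) + (\<Sum>\<^sub>\<infinity>i. g (inr i))) (range (\<lambda>i. inl i) \<union> range (\<lambda>i. inr i))"
    by (rule has_sum_Un_disjoint) (auto simp: fold_sum_eq_iff)
  moreover have "range (\<lambda>i. inl i) \<union> range (\<lambda>i. inr i) = (UNIV :: 'k set)"
  proof (rule UNIV_eq_I[symmetric])
    fix p :: 'k show "p \<in> range (\<lambda>i. inl i) \<union> range (\<lambda>i. inr i)"
      by (cases p rule: fold_sum_cases) auto
  qed
  ultimately show "(g has_sum (\<Sum>\<^sub>\<infinity>i. g (inl i)) + (\<Sum>\<^sub>\<infinity>i. g (inr i))) UNIV" by simp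
qed

text \<open>Each entry on the right is a sum over both halves of the index type; the two real sums
  so obtained are those of \<open>infsum_scaleC_pair\<close>, with the signs of the block
  pattern.\<close>

lemma c_mat_lmul:
  fixes x :: "'k \<Rightarrow> 'k \<Rightarrow> 'e::banach \<times> 'e"
  assumes "\<And>p. bounded_vec (\<alpha> p)" "\<And>q. bounded_vec (\<lambda>k. x k q)"
  shows "c_mat (lmul scaleC_pair \<alpha> x) = lmul scaleR (c_mat (cpair \<alpha>)) (c_mat x)"
proof -
  have "(\<lambda>k. Re (\<alpha> p k) *\<^sub>R fst (x k q)) summable_on UNIV" "(\<lambda>k. Re (\<alpha> p k) *\<^sub>R snd (x k q)) summable_on UNIV"
    "(\<lambda>k. Im (\<alpha> p k) *\<^sub>R fst (x k q)) summable_on UNIV" "(\<lambda>k. Im (\<alpha> p k) *\<^sub>R snd (x k q)) summable_on UNIV" for p q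
    using assms by (intro bounded_vec_summable bounded_vec_Re bounded_vec_Im bounded_vec_fst bounded_vec_snd; simp)+
  note summable = this
  show ?thesis
    by (rule block_eqI) (simp_all add: lmul_def c_mat_simps infsum_double infsum_scaleC_pair assms summable
        summable_on_uminus infsum_uminus cpair_def)
qed

lemma c_mat_rmul:
  fixes x :: "'k \<Rightarrow> 'k \<Rightarrow> 'e::banach \<times> 'e"
  assumes "\<And>p. bounded_vec (x p)" "\<And>q. bounded_vec (\<lambda>k. \<alpha> k q)"
  shows "c_mat (rmul scaleC_pair x \<alpha>) = rmul scaleR (c_mat x) (c_mat (cpair \<alpha>))"
proof -
  have "(\<lambda>k. Re (\<alpha> k q) *\<^sub>R fst (x p k)) summable_on UNIV" "(\<lambda>k. Re (\<alpha> k q) *\<^sub>R snd (x p k)) summable_on UNIV"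
    "(\<lambda>k. Im (\<alpha> k q) *\<^sub>R fst (x p k)) summable_on UNIV" "(\<lambda>k. Im (\<alpha> k q) *\<^sub>R snd (x p k)) summable_on UNIV" for p q
    using assms by (intro bounded_vec_summable bounded_vec_Re bounded_vec_Im bounded_vec_fst bounded_vec_snd; simp)+
  note summable = this
  show ?thesis
    by (rule block_eqI) (simp_all add: rmul_def c_mat_simps infsum_double infsum_scaleC_pair assms summable
        summable_on_uminus infsum_uminus cpair_def)
qed

text \<open>Negating the imaginary part and transposing the block pattern both exchange the signs
  off the diagonal.\<close>

lemma c_mat_adj: "c_mat (cpair (adj \<alpha>)) = adj (c_mat (cpair (\<alpha> :: 'k \<Rightarrow> 'k \<Rightarrow> complex)))"
  by (rule block_eqI) (simp_all add: adj_def c_mat_simps cpair_def)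

lemma c_mat_id_mat: "c_mat (cpair (id_mat I)) = id_mat (double (I :: 'k set))"
  by (rule block_eqI) (auto simp: id_mat_def block_simps cpair_def)

text \<open>c(z) is the sum of four zero-padded blocks, each a reindexed component of
  \<open>z\<close>. The maps \<open>l\<close> and \<open>r\<close> matter only on the halves
  \<open>L\<close> and \<open>R\<close>, where they invert \<open>inl\<close> and
  \<open>inr\<close>.\<close>

lemma bounded_form_c_mat:
  fixes z :: "'k \<Rightarrow> 'k \<Rightarrow> 'e::real_normed_vector \<times> 'e"
  assumes "bounded_form z"
  shows "bounded_form (c_mat z)"
proof -
  define L where "L = range (\<lambda>i. inl i :: 'k)"
  define R where "R = range (\<lambda>i. inr i :: 'k)"
  define l where "l p = projl (inv fold_sum p)" for p :: 'k
  define r where "r p = projr (inv fold_sum p)" for p :: 'k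
  have inj: "inj_on l L" "inj_on r R"
    by (auto intro!: inj_onI simp: L_def R_def l_def r_def inv_fold_sum)
  have "c_mat z = (\<lambda>p q. ((if p \<in> L \<and> q \<in> L then fst (z (l p) (l q)) else 0)
        + (if p \<in> L \<and> q \<in> R then - snd (z (l p) (r q)) else 0))
      + ((if p \<in> R \<and> q \<in> L then snd (z (r p) (l q)) else 0)
        + (if p \<in> R \<and> q \<in> R then fst (z (r p) (r q)) else 0)))"
    by (rule block_eqI) (auto simp: c_mat_simps L_def R_def l_def r_def fold_sum_eq_iff inv_fold_sum)
  moreover have "bounded_form \<dots>"
    using bounded_form_fst[OF assms] bounded_form_snd[OF assms]
    by (intro bounded_form_add bounded_form_reindex[where x = "\<lambda>i j. fst (z i j)"]
        bounded_form_reindex[where x = "\<lambda>i j. snd (z i j)"]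
        bounded_form_reindex[where x = "\<lambda>i j. - snd (z i j)"] bounded_form_uminus inj)
  ultimately show ?thesis by metis
qed

section \<open>Isometries and dilations under c\<close>

lemma c_mat_isometry:
  assumes "\<alpha> \<in> isometries J (I :: 'k set)"
  shows "c_mat (cpair \<alpha>) \<in> isometries (double J) (double I)"
proof -
  have mats: "\<alpha> \<in> scalar_mats J I" and iso: "lmul (*) (adj \<alpha>) \<alpha> = id_mat I"
    using assms by (auto simp: isometries_def)
  have ba: "bounded_form \<alpha>" by (rule bounded_form_scalar_mats[OF mats])
  have "c_mat (cpair \<alpha>) \<in> scalar_mats (double J) (double I)"
  proof (rule scalar_mats_realI)
    show "bounded_form (c_mat (cpair \<alpha>))" by (intro bounded_form_c_mat bounded_form_cpair ba)
    show "p \<in> double J \<and> q \<in> double I" if "c_mat (cpair \<alpha>) p q \<noteq> 0" for p q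
    proof -
      have "\<alpha> j i \<noteq> 0 \<Longrightarrow> j \<in> J \<and> i \<in> I" for j i
        using mats by (auto simp: scalar_mats_def)
      then show ?thesis using that
        by (cases p rule: fold_sum_cases; cases q rule: fold_sum_cases)
          (auto simp: block_simps cpair_def complex_eq_iff)
    qed
  qed
  moreover have "lmul (*) (adj (c_mat (cpair \<alpha>))) (c_mat (cpair \<alpha>)) = id_mat (double I)"
  proof -
    have adj: "bounded_form (adj \<alpha>)" by (rule bounded_form_adj_complex[OF ba])
    have "lmul (*) (adj (c_mat (cpair \<alpha>))) (c_mat (cpair \<alpha>)) = c_mat (lmul scaleC_pair (adj \<alpha>) (cpair \<alpha>))"
      unfolding lmul_mult_real c_mat_adj[symmetric]
      by (rule c_mat_lmul[symmetric]; intro bounded_form_row[OF adj] bounded_form_col bounded_form_cpair ba)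
    also have "lmul scaleC_pair (adj \<alpha>) (cpair \<alpha>) = cpair (id_mat I)"
      unfolding iso[symmetric]
      by (rule cpair_lmul[symmetric]; intro bounded_form_row[OF adj] bounded_form_col ba)
    finally show ?thesis by (simp add: c_mat_id_mat)
  qed
  ultimately show ?thesis by (simp add: isometries_def)
qed

lemma dilation_c_mat:
  fixes z :: "'k \<Rightarrow> 'k \<Rightarrow> 'e::banach \<times> 'e"
  assumes "bounded_form z" "dilation scaleC_pair I x J z \<alpha>"
  shows "dilation scaleR (double I) (c_mat x) (double J) (c_mat z) (c_mat (cpair \<alpha>))"
proof -
  have iso: "\<alpha> \<in> isometries J I" and x: "x = lmul scaleC_pair (adj \<alpha>) (rmul scaleC_pair z \<alpha>)"
    using assms(2) by (auto simp: dilation_def)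
  have ba: "bounded_form \<alpha>" using iso by (auto simp: isometries_def intro: bounded_form_scalar_mats)
  have adj: "bounded_form (adj \<alpha>)" by (rule bounded_form_adj_complex[OF ba])
  have "c_mat x = lmul scaleR (c_mat (cpair (adj \<alpha>))) (c_mat (rmul scaleC_pair z \<alpha>))"
    unfolding x by (rule c_mat_lmul; intro bounded_form_row[OF adj] bounded_vec_rmul_scaleC_pair
        assms(1) bounded_form_col ba)
  also have "c_mat (rmul scaleC_pair z \<alpha>) = rmul scaleR (c_mat z) (c_mat (cpair \<alpha>))"
    by (rule c_mat_rmul; intro bounded_form_row[OF assms(1)] bounded_form_col ba)
  finally show ?thesis using c_mat_isometry[OF iso] by (simp add: dilation_def c_mat_adj)
qed

text \<open>c carries \<open>\<alpha> \<alpha>^*\<close> to the corresponding product for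
  c(\<alpha>), and both sides of the commutation relation for \<open>z\<close> to those for c(z);
  injectivity of c gives the way back.\<close>

lemma trivial_dilation_c_mat_iff:
  fixes z :: "'k \<Rightarrow> 'k \<Rightarrow> 'e::banach \<times> 'e"
  assumes bz: "bounded_form z" and ba: "bounded_form \<alpha>"
  shows "trivial_dilation scaleR (c_mat z) (c_mat (cpair \<alpha>)) \<longleftrightarrow> trivial_dilation scaleC_pair z \<alpha>"
proof -
  let ?P = "lmul (*) \<alpha> (adj \<alpha>)"
  have adj: "bounded_form (adj \<alpha>)" by (rule bounded_form_adj_complex[OF ba])
  have "lmul (*) (c_mat (cpair \<alpha>)) (adj (c_mat (cpair \<alpha>))) = c_mat (lmul scaleC_pair \<alpha> (cpair (adj \<alpha>)))"
    unfolding lmul_mult_real c_mat_adj[symmetric]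
    by (rule c_mat_lmul[symmetric]; intro bounded_form_row[OF ba] bounded_form_col bounded_form_cpair adj)
  also have "lmul scaleC_pair \<alpha> (cpair (adj \<alpha>)) = cpair ?P"
    by (rule cpair_lmul[symmetric]; intro bounded_form_row[OF ba] bounded_form_col adj)
  finally have P: "lmul (*) (c_mat (cpair \<alpha>)) (adj (c_mat (cpair \<alpha>))) = c_mat (cpair ?P)" .
  have "c_mat (rmul scaleC_pair z ?P) = rmul scaleR (c_mat z) (c_mat (cpair ?P))"
    by (rule c_mat_rmul; intro bounded_form_row[OF bz] bounded_vec_product_adj ba)
  moreover have "c_mat (lmul scaleC_pair ?P z) = lmul scaleR (c_mat (cpair ?P)) (c_mat z)"
    by (rule c_mat_lmul; intro bounded_form_col[OF bz] bounded_vec_product_adj ba)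
  ultimately show ?thesis
    unfolding trivial_dilation_def P by (metis c_mat_inject)
qed

end

section \<open>Direct sums\<close>

text \<open>The coordinate map sending the basis vector at \<open>k\<close> in \<open>J\<close> to
  the one at \<open>h k\<close>.\<close>

definition embedding :: "('k \<Rightarrow> 'k) \<Rightarrow> 'k set \<Rightarrow> 'k \<Rightarrow> 'k \<Rightarrow> real" where
  "embedding h J = (\<lambda>p k. if p = h k \<and> k \<in> J then 1 else 0)"

lemma infsum_single:
  fixes f :: "'a \<Rightarrow> 'e::{comm_monoid_add, t2_space}"
  assumes "\<And>k. k \<noteq> a \<Longrightarrow> f k = 0"
  shows "(\<Sum>\<^sub>\<infinity>k. f k) = f a"
proof -
  have "(\<Sum>\<^sub>\<infinity>k. f k) = (\<Sum>\<^sub>\<infinity>k\<in>{a}. f k)" by (rule infsum_cong_neutral) (auto simp: assms)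
  then show ?thesis by simp
qed

lemma embedding_isometry:
  assumes h: "inj h" and "h ` J \<subseteq> J'"
  shows "embedding h J \<in> isometries J' J"
proof -
  \<comment> \<open>The embedding is the identity matrix with columns relabelled by \<open>h\<close>
    and cut down to \<open>J\<close>.\<close>
  have "bounded_form (\<lambda>p k. if p \<in> UNIV \<and> k \<in> J then (\<lambda>s t. if s = t then 1 else 0 :: real) (id p) (h k) else 0)"
    using inj_on_subset[OF h, of J] by (intro bounded_form_reindex bounded_form_identity) auto
  also have "(\<lambda>p k. if p \<in> UNIV \<and> k \<in> J then (\<lambda>s t. if s = t then 1 else 0 :: real) (id p) (h k) else 0)
      = embedding h J"
    by (auto simp: embedding_def fun_eq_iff)
  finally have "embedding h J \<in> scalar_mats J' J"
    using assms(2) by (intro scalar_mats_realI) (auto simp: embedding_def split: if_splits)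
  moreover have "lmul (*) (adj (embedding h J)) (embedding h J) = id_mat J"
  proof (intro ext)
    fix i j
    have "lmul (*) (adj (embedding h J)) (embedding h J) i j = embedding h J (h i) i * embedding h J (h i) j"
      unfolding lmul_def adj_def conjugate_real_def
      by (rule infsum_single) (simp add: embedding_def)
    then show "lmul (*) (adj (embedding h J)) (embedding h J) i j = id_mat J i j"
      using h by (auto simp: embedding_def id_mat_def inj_eq)
  qed
  ultimately show ?thesis by (simp add: isometries_def)
qed

text \<open>At most one \<open>k\<close> satisfies \<open>h k = p\<close>, so a diagonal projection
  results. Two of these with complementary ranges will add up to the identity.\<close>

lemma embedding_range:
  assumes "inj h"
  shows "lmul (*) (embedding h J) (adj (embedding h J)) p q = (if p = q \<and> p \<in> h ` J then 1 else 0)"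
proof (cases "p \<in> range h")
  case True
  then obtain k where k: "p = h k" by blast
  have "lmul (*) (embedding h J) (adj (embedding h J)) p q = embedding h J p k * embedding h J q k"
    unfolding lmul_def adj_def conjugate_real_def
    by (rule infsum_single) (use assms k in \<open>auto simp: embedding_def inj_eq\<close>)
  then show ?thesis using assms k by (auto simp: embedding_def inj_eq inj_image_mem_iff)
next
  case False
  then have "embedding h J p k = 0" for k by (auto simp: embedding_def)
  then show ?thesis using False by (auto simp: lmul_def)
qed

text \<open>Injectivity leaves one term in each sum, so the conjugation relabels \<open>y\<close>
  along \<open>h\<close>; at an index outside the range the corresponding row of the embedding is
  zero.\<close>

lemma embedding_conjugation:
  fixes y :: "'k \<Rightarrow> 'k \<Rightarrow> 'e::real_normed_vector"
  assumes "inj h" and supp: "\<And>k l. y k l \<noteq> 0 \<Longrightarrow> k \<in> J \<and> l \<in> J"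
  shows "lmul scaleR (embedding h J) (rmul scaleR y (adj (embedding h J))) (h k) (h l) = y k l"
    and "p \<notin> range h \<or> q \<notin> range h \<Longrightarrow>
      lmul scaleR (embedding h J) (rmul scaleR y (adj (embedding h J))) p q = 0"
proof -
  have r: "rmul scaleR y (adj (embedding h J)) k (h l) = embedding h J (h l) l *\<^sub>R y k l" for k l
    unfolding rmul_def adj_def conjugate_real_def
    by (rule infsum_single) (use assms in \<open>auto simp: embedding_def inj_eq\<close>)
  have "lmul scaleR (embedding h J) (rmul scaleR y (adj (embedding h J))) (h k) (h l)
      = embedding h J (h k) k *\<^sub>R (embedding h J (h l) l *\<^sub>R y k l)"
    unfolding lmul_def r[symmetric]
    by (rule infsum_single) (use assms in \<open>auto simp: embedding_def inj_eq\<close>)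
  also have "\<dots> = y k l" using supp[of k l] by (auto simp: embedding_def)
  finally show "lmul scaleR (embedding h J) (rmul scaleR y (adj (embedding h J))) (h k) (h l) = y k l" .
  assume "p \<notin> range h \<or> q \<notin> range h"
  then have "(\<forall>k. embedding h J p k = 0) \<or> (\<forall>k. embedding h J q k = 0)"
    by (auto simp: embedding_def)
  then show "lmul scaleR (embedding h J) (rmul scaleR y (adj (embedding h J))) p q = 0"
    by (auto simp: lmul_def rmul_def adj_def)
qed

lemma real_nc_convex_subset: "real_nc_convex nV K \<Longrightarrow> J \<noteq> {} \<Longrightarrow> K J \<subseteq> dual_mats nV J"
  by (simp add: real_nc_convex_def)

text \<open>The matrix is the direct sum of two copies of \<open>y\<close>, placed on the two halves
  of \<open>double J\<close> by coordinate embeddings. It puts \<open>y + \<i> 0\<close> into the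
  complexification.\<close>

lemma direct_sum_mem:
  fixes K :: "'k set \<Rightarrow> ('k \<Rightarrow> 'k \<Rightarrow> ('v::banach) dual) set"
  assumes inf: "infinite (UNIV :: 'k set)" and K: "real_nc_convex nV K"
    and J: "J \<noteq> {}" and y: "y \<in> K J"
  shows "c_mat (\<lambda>i j. (y i j, 0)) \<in> K (double J)"
proof -
  note block = fold_sum_eq_iff[OF inf] inl_mem_double[OF inf] inr_mem_double[OF inf] c_mat_simps[OF inf]
  have dm: "y \<in> dual_mats nV J" using real_nc_convex_subset[OF K J] y by blast
  have supp: "k \<in> J \<and> l \<in> J" if "y k l \<noteq> 0" for k l
    using dm that unfolding dual_mats_def by auto
  have "\<exists>C. \<forall>S. finite S \<and> S \<subseteq> J \<longrightarrow> dual_norm_le nV S y C"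
    using dm unfolding dual_mats_def by simp
  then obtain C where C: "\<forall>S. finite S \<and> S \<subseteq> J \<longrightarrow> dual_norm_le nV S y C" by blast
  define h1 where "h1 i = (inl i :: 'k)" for i
  define h2 where "h2 i = (inr i :: 'k)" for i
  have h: "inj h1" "inj h2" by (auto intro!: injI simp: h1_def h2_def block)
  \<comment> \<open>The summands of a direct sum are indexed by elements of \<open>'k\<close>. Any
    two distinct labels do: the argument \<open>undefined\<close> is arbitrary, and the tags
    \<open>Inl\<close> and \<open>Inr\<close> separate them.\<close>
  define l1 where "l1 = (inl undefined :: 'k)"
  define l2 where "l2 = (inr undefined :: 'k)"
  have l: "l1 \<noteq> l2" by (simp add: l1_def l2_def block)
  define \<alpha> where "\<alpha> i = embedding (if i = l1 then h1 else h2) J" for i :: 'k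
  have \<alpha>: "\<alpha> l1 = embedding h1 J" "\<alpha> l2 = embedding h2 J" using l by (auto simp: \<alpha>_def)
  have "double J \<noteq> {}" using J by (auto simp: double_def)
  moreover have "\<alpha> i \<in> isometries (double J) J" for i
    using h unfolding \<alpha>_def by (intro embedding_isometry) (auto simp: h1_def h2_def block)
  \<comment> \<open>The ranges of the two embeddings are the left and right halves, which partition
    \<open>double J\<close>.\<close>
  moreover have "((\<lambda>i. lmul (*) (\<alpha> i) (adj (\<alpha> i)) p q) has_sum id_mat (double J) p q) {l1, l2}" for p q
  proof (rule has_sum_finiteI)
    show "id_mat (double J) p q = (\<Sum>i\<in>{l1, l2}. lmul (*) (\<alpha> i) (adj (\<alpha> i)) p q)"
      using l h by (cases p rule: fold_sum_cases[OF inf])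
        (auto simp: \<alpha> embedding_range id_mat_def block h1_def h2_def image_iff)
  qed simp
  \<comment> \<open>Both members of the family are \<open>y\<close>, so the bound \<open>C\<close>
    for \<open>y\<close> serves the whole family.\<close>
  ultimately have "(\<lambda>p q. \<Sum>\<^sub>\<infinity>i\<in>{l1, l2}. lmul scaleR (\<alpha> i) (rmul scaleR y (adj (\<alpha> i))) p q) \<in> K (double J)"
    by (intro K[unfolded real_nc_convex_def, THEN conjunct2, THEN conjunct1, rule_format,
        where N = "\<lambda>_. J"] conjI ballI exI[of _ C]) (use J y C in simp_all)
  also have "(\<lambda>p q. \<Sum>\<^sub>\<infinity>i\<in>{l1, l2}. lmul scaleR (\<alpha> i) (rmul scaleR y (adj (\<alpha> i))) p q)
      = c_mat (\<lambda>i j. (y i j, 0))"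
  proof -
    let ?D = "\<lambda>h. lmul scaleR (embedding h J) (rmul scaleR y (adj (embedding h J)))"
    have off: "inr i \<notin> range h1" "inl i \<notin> range h2" for i by (auto simp: h1_def h2_def block)
    have "?D h1 (inl i) (inl j) = y i j" "?D h2 (inr i) (inr j) = y i j" for i j
      using embedding_conjugation(1)[OF h(1) supp] embedding_conjugation(1)[OF h(2) supp]
      unfolding h1_def[symmetric] h2_def[symmetric] by blast+
    moreover have "?D h1 (inr i) q = 0" "?D h1 q (inr i) = 0" "?D h2 (inl i) q = 0" "?D h2 q (inl i) = 0" for i q
      using off embedding_conjugation(2)[OF h(1) supp] embedding_conjugation(2)[OF h(2) supp] by blast+
    ultimately show ?thesis
      using l by (intro block_eqI[OF inf]) (simp_all add: \<alpha> block)
  qed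
  finally show ?thesis .
qed

text \<open>Supplies the imaginary part of \<open>y + \<i> 0\<close>.\<close>

lemma zero_mem_dual_mats: "(\<lambda>_ _. 0) \<in> dual_mats nV I"
proof -
  have "dual_norm_le nV S (\<lambda>_ _. 0) 0" for S :: "'a set"
    by (simp add: dual_norm_le_def op_norm_le_def case_prod_unfold L2_set_def)
  then show ?thesis unfolding dual_mats_def by auto
qed

section \<open>Real dilations of the block matrix\<close>

definition sqrt_half :: real where
  "sqrt_half = sqrt (1 / 2)"

text \<open>The product \<open>\<alpha> u\<close> written out, where column \<open>i\<close> of
  \<open>u\<close> has the entries \<open>1 / sqrt 2\<close> at \<open>inl i\<close> and
  \<open>-\<i> / sqrt 2\<close> at \<open>inr i\<close>. The sign fits the block pattern: with
  \<open>+\<i>\<close> the matrix c(a + \<i> b) would act as \<open>a - \<i> b\<close>.\<close>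

definition half_isometry :: "('k \<Rightarrow> 'k \<Rightarrow> real) \<Rightarrow> 'k \<Rightarrow> 'k \<Rightarrow> complex" where
  "half_isometry \<alpha> = (\<lambda>j i. Complex (sqrt_half * \<alpha> j (inl i)) (- (sqrt_half * \<alpha> j (inr i))))"

lemma Re_half_isometry: "Re (half_isometry \<alpha> j i) = sqrt_half * \<alpha> j (inl i)"
  and Im_half_isometry: "Im (half_isometry \<alpha> j i) = - (sqrt_half * \<alpha> j (inr i))"
  by (simp_all add: half_isometry_def)

lemma Re_adj: "Re (adj \<beta> i j) = Re (\<beta> j i)" and Im_adj: "Im (adj \<beta> i j) = - Im (\<beta> j i)"
  by (simp_all add: adj_def)

lemma sqrt_half_mult: "(sqrt_half * a) * (sqrt_half * b) = a * b / 2"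
proof -
  have "(sqrt_half * a) * (sqrt_half * b) = (sqrt_half * sqrt_half) * (a * b)" by (simp only: mult_ac)
  also have "sqrt_half * sqrt_half = 1 / 2" by (simp add: sqrt_half_def del: real_sqrt_divide)
  finally show ?thesis by simp
qed

lemma scaleR_sqrt_half:
  fixes v :: "'e::real_vector"
  shows "(sqrt_half * a) *\<^sub>R (sqrt_half *\<^sub>R v) = (1 / 2) *\<^sub>R (a *\<^sub>R v)"
proof -
  have "(sqrt_half * a) * sqrt_half = (1 / 2) * a" using sqrt_half_mult[of a 1] by simp
  then show ?thesis unfolding scaleR_scaleR by (rule arg_cong)
qed

lemma infsum_half: "(\<Sum>\<^sub>\<infinity>k. f k / 2) = (\<Sum>\<^sub>\<infinity>k. f k :: real) / 2"
  using infsum_cmult_left'[of f "1 / 2" UNIV] by simp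

context
  fixes \<alpha> :: "'k \<Rightarrow> 'k \<Rightarrow> real" and I J :: "'k set"
  assumes inf: "infinite (UNIV :: 'k set)" and iso: "\<alpha> \<in> isometries J (double I)"
begin

lemma bounded_form_\<alpha>: "bounded_form \<alpha>"
  using iso by (auto simp: isometries_def intro: bounded_form_scalar_mats)

lemma bounded_form_half:
  "bounded_form (\<lambda>j i. \<alpha> j (inl i))" "bounded_form (\<lambda>j i. \<alpha> j (inr i))"
  using bounded_form_reindex[OF bounded_form_\<alpha>, of id UNIV "\<lambda>i. inl i" UNIV]
    bounded_form_reindex[OF bounded_form_\<alpha>, of id UNIV "\<lambda>i. inr i" UNIV]
  by (simp_all add: inj_on_def fold_sum_eq_iff[OF inf])

lemma bounded_form_Re_Im_half_isometry:
  "bounded_form (\<lambda>j i. Re (half_isometry \<alpha> j i))" "bounded_form (\<lambda>j i. Im (half_isometry \<alpha> j i))"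
  unfolding Re_half_isometry Im_half_isometry
  by (intro bounded_form_uminus bounded_form_bounded_linear[OF bounded_linear_mult_right] bounded_form_half)+

lemma half_isometry_mem_scalar_mats: "half_isometry \<alpha> \<in> scalar_mats J I"
proof (rule scalar_mats_complexI[OF bounded_form_Re_Im_half_isometry])
  fix j i assume "half_isometry \<alpha> j i \<noteq> 0"
  then have "\<alpha> j (inl i) \<noteq> 0 \<or> \<alpha> j (inr i) \<noteq> 0" by (auto simp: complex_eq_iff Re_half_isometry Im_half_isometry)
  moreover have "p \<in> J \<and> q \<in> double I" if "\<alpha> p q \<noteq> 0" for p q
    using iso that by (auto simp: isometries_def scalar_mats_def)
  ultimately show "j \<in> J \<and> i \<in> I"
    using inl_mem_double[OF inf, of i I] inr_mem_double[OF inf, of i I] by blast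
qed

lemma bounded_form_half_isometry: "bounded_form (half_isometry \<alpha>)"
  by (rule bounded_form_scalar_mats[OF half_isometry_mem_scalar_mats])

text \<open>The real part of \<open>\<beta>^* \<beta>\<close> is the average of the two diagonal
  blocks of \<open>\<alpha>^* \<alpha>\<close>, and the imaginary part half the difference of its
  off-diagonal blocks. As \<open>\<alpha>\<close> is an isometry, these are the identity and
  zero.\<close>

lemma half_isometry_isometry: "half_isometry \<alpha> \<in> isometries J I"
proof -
  let ?\<beta> = "half_isometry \<alpha>"
  have adj: "bounded_form (adj ?\<beta>)" by (rule bounded_form_adj_complex[OF bounded_form_half_isometry])
  have G: "(\<Sum>\<^sub>\<infinity>k. \<alpha> k p * \<alpha> k q) = id_mat (double I) p q" for p q
  proof -
    have "lmul (*) (adj \<alpha>) \<alpha> p q = id_mat (double I) p q"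
      using iso by (simp add: isometries_def)
    then show ?thesis by (simp add: lmul_def adj_def)
  qed
  have "lmul (*) (adj ?\<beta>) ?\<beta> p q = id_mat I p q" for p q
    unfolding lmul_def
      infsum_complex_mult[OF bounded_form_row[OF adj] bounded_form_col[OF bounded_form_half_isometry]]
    by (simp add: Re_adj Im_adj Re_half_isometry Im_half_isometry sqrt_half_mult infsum_uminus
        infsum_half G)
      (auto simp: id_mat_def complex_eq_iff fold_sum_eq_iff[OF inf] inl_mem_double[OF inf] inr_mem_double[OF inf])
  then show ?thesis using half_isometry_mem_scalar_mats by (auto simp: isometries_def)
qed

text \<open>The components of \<open>\<beta>^* y \<beta>\<close> are the average of the diagonal
  blocks of c(x), both equal to the real part of \<open>x\<close>, and half the difference of the
  lower left and upper right blocks, which are plus and minus its imaginary part.\<close>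

lemma dilation_half_isometry:
  fixes y :: "'k \<Rightarrow> 'k \<Rightarrow> 'e::banach"
  assumes y: "bounded_form y" and x: "c_mat x = lmul scaleR (adj \<alpha>) (rmul scaleR y \<alpha>)"
  shows "dilation scaleC_pair I x J (\<lambda>i j. (y i j, 0)) (half_isometry \<alpha>)"
proof -
  let ?\<beta> = "half_isometry \<alpha>" and ?y = "\<lambda>i j. (y i j, 0)"
  have adj: "bounded_form (adj ?\<beta>)" by (rule bounded_form_adj_complex[OF bounded_form_half_isometry])
  have by': "bounded_form ?y" by (intro bounded_form_Pair y bounded_form_0)
  \<comment> \<open>The entries of \<open>y \<alpha>\<close> are kept as units, so the outer sums
    are exactly entries of c(x) and no double sum has to be reordered.\<close>
  have r: "rmul scaleC_pair ?y ?\<beta> k q =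
      (sqrt_half *\<^sub>R rmul scaleR y \<alpha> k (inl q), - (sqrt_half *\<^sub>R rmul scaleR y \<alpha> k (inr q)))" for k q
    unfolding rmul_def
      infsum_scaleC_pair[OF bounded_form_col[OF bounded_form_half_isometry] bounded_form_row[OF by']]
    by (simp add: Re_half_isometry Im_half_isometry infsum_uminus flip: scaleR_scaleR infsum_scaleR_right
       )
  have G: "(\<Sum>\<^sub>\<infinity>k. \<alpha> k p *\<^sub>R rmul scaleR y \<alpha> k q) = c_mat x p q" for p q
    unfolding x by (simp add: lmul_def adj_def)
  have "lmul scaleC_pair (adj ?\<beta>) (rmul scaleC_pair ?y ?\<beta>) p q = x p q" for p q
    unfolding lmul_def infsum_scaleC_pair[OF bounded_form_row[OF adj]
        bounded_vec_rmul_scaleC_pair[OF by' bounded_form_col[OF bounded_form_half_isometry]]]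
    unfolding r
    by (simp only: Re_adj Im_adj Re_half_isometry Im_half_isometry fst_conv snd_conv minus_minus
        scaleR_minus_right scaleR_sqrt_half infsum_uminus infsum_scaleR_right G c_mat_simps[OF inf])
      (simp add: prod_eq_iff flip: scaleR_add_left)
  then show ?thesis unfolding dilation_def using half_isometry_isometry by (auto simp: fun_eq_iff)
qed

text \<open>The real part of \<open>\<beta> p i\<close> times the conjugate of
  \<open>\<beta> q i\<close> is half the sum of the \<open>inl i\<close> and \<open>inr i\<close>
  terms of \<open>\<alpha> \<alpha>^*\<close>; summing over \<open>i\<close> runs through both
  halves of the index type.\<close>

lemma Re_half_isometry_range:
  "Re (lmul (*) (half_isometry \<alpha>) (adj (half_isometry \<alpha>)) p q) = (1 / 2) * lmul (*) \<alpha> (adj \<alpha>) p q"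
proof -
  let ?\<beta> = "half_isometry \<alpha>"
  have adj: "bounded_form (adj ?\<beta>)" by (rule bounded_form_adj_complex[OF bounded_form_half_isometry])
  have sum: "(\<lambda>i. \<alpha> p (inl i) * \<alpha> q (inl i)) summable_on UNIV" "(\<lambda>i. \<alpha> p (inr i) * \<alpha> q (inr i)) summable_on UNIV"
    using bounded_vec_summable[OF bounded_form_row[OF bounded_form_half(1)] bounded_form_row[OF bounded_form_half(1)]]
      bounded_vec_summable[OF bounded_form_row[OF bounded_form_half(2)] bounded_form_row[OF bounded_form_half(2)]]
    by simp_all
  have Q: "lmul (*) \<alpha> (adj \<alpha>) p q = (\<Sum>\<^sub>\<infinity>i. \<alpha> p (inl i) * \<alpha> q (inl i)) + (\<Sum>\<^sub>\<infinity>i. \<alpha> p (inr i) * \<alpha> q (inr i))"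
    unfolding lmul_def adj_def conjugate_real_def by (rule infsum_double[OF inf sum])
  show ?thesis
    unfolding Q unfolding lmul_def
      infsum_complex_mult[OF bounded_form_row[OF bounded_form_half_isometry] bounded_form_col[OF adj]]
    by (simp add: Re_adj Im_adj Re_half_isometry Im_half_isometry sqrt_half_mult infsum_uminus
        infsum_half add_divide_distrib)
qed

lemma trivial_dilation_half_isometry:
  fixes y :: "'k \<Rightarrow> 'k \<Rightarrow> 'e::banach"
  assumes y: "bounded_form y"
    and triv: "trivial_dilation scaleC_pair (\<lambda>i j. (y i j, 0)) (half_isometry \<alpha>)"
  shows "trivial_dilation scaleR y \<alpha>"
proof -
  let ?\<beta> = "half_isometry \<alpha>" and ?y = "\<lambda>i j. (y i j, 0)"
  let ?P = "lmul (*) ?\<beta> (adj ?\<beta>)" and ?Q = "lmul (*) \<alpha> (adj \<alpha>)"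
  have by': "bounded_form ?y" by (intro bounded_form_Pair y bounded_form_0)
  note P = bounded_vec_product_adj[OF bounded_form_half_isometry]
  \<comment> \<open>As \<open>?y\<close> has zero imaginary part, the first component of the product
    involves only the real part of \<open>?P\<close>, that is, half of \<open>?Q\<close>.\<close>
  have "fst (rmul scaleC_pair ?y ?P k q) = (1 / 2) *\<^sub>R rmul scaleR y ?Q k q" for k q
    unfolding rmul_def infsum_scaleC_pair[OF P(2) bounded_form_row[OF by']] Re_half_isometry_range
    by (simp only: fst_conv snd_conv scaleR_zero_right infsum_0_simp diff_zero infsum_scaleR_right
        flip: scaleR_scaleR)
  moreover have "fst (lmul scaleC_pair ?P ?y k q) = (1 / 2) *\<^sub>R lmul scaleR ?Q y k q" for k q
    unfolding lmul_def[of scaleC_pair] lmul_def[of scaleR]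
      infsum_scaleC_pair[OF P(1) bounded_form_col[OF by']] Re_half_isometry_range
    by (simp only: fst_conv snd_conv scaleR_zero_right infsum_0_simp diff_zero infsum_scaleR_right
        flip: scaleR_scaleR)
  ultimately have "(1 / 2) *\<^sub>R rmul scaleR y ?Q k q = (1 / 2) *\<^sub>R lmul scaleR ?Q y k q" for k q
    using triv unfolding trivial_dilation_def by metis
  then show ?thesis unfolding trivial_dilation_def by (auto simp: fun_eq_iff)
qed

end

section \<open>Equivalence of maximality for x and c(x)\<close>

theorem theorem2p6:
  fixes nV :: "nat \<Rightarrow> (nat \<Rightarrow> nat \<Rightarrow> 'v::banach) \<Rightarrow> real"
    and K :: "'k set \<Rightarrow> ('k \<Rightarrow> 'k \<Rightarrow> 'v dual) set"
    and I :: "'k set"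
    and x :: "'k \<Rightarrow> 'k \<Rightarrow> 'v dual \<times> 'v dual"
  assumes "infinite (UNIV :: 'k set)"
    and "real_operator_space nV"
    and "real_compact_nc_convex nV K"
    and "I \<noteq> {}"
    and "x \<in> complexification nV K I"
  shows "maximal scaleC_pair (complexification nV K) I x \<longleftrightarrow> maximal scaleR K (double I) (c_mat x)"
proof
  note inf = assms(1) and nV = assms(2)
  have K: "real_nc_convex nV K" using assms(3) by (simp add: real_compact_nc_convex_def)
  {
    assume max: "maximal scaleC_pair (complexification nV K) I x"
    show "maximal scaleR K (double I) (c_mat x)"
      unfolding maximal_def
    proof (intro conjI allI impI; (elim conjE)?)
      show "c_mat x \<in> K (double I)" using assms(5) by (simp add: complexification_def)
      fix J y \<alpha>
      assume J: "J \<noteq> {}" and y: "y \<in> K J" and dil: "dilation scaleR (double I) (c_mat x) J y \<alpha>"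
      have iso: "\<alpha> \<in> isometries J (double I)" and x: "c_mat x = lmul scaleR (adj \<alpha>) (rmul scaleR y \<alpha>)"
        using dil by (auto simp: dilation_def)
      have ydm: "y \<in> dual_mats nV J" using real_nc_convex_subset[OF K J] y by blast
      have y': "bounded_form y" by (rule bounded_form_dual_mats[OF nV ydm])
      \<comment> \<open>Maximality of \<open>x\<close> is tested on points of the complexification,
        so the real dilation \<open>y\<close> is first moved there.\<close>
      have "(\<lambda>i j. (y i j, 0)) \<in> complexification nV K J"
        using direct_sum_mem[OF inf K J y] ydm by (simp add: complexification_def zero_mem_dual_mats)
      then have "trivial_dilation scaleC_pair (\<lambda>i j. (y i j, 0)) (half_isometry \<alpha>)"
        using max J dilation_half_isometry[OF inf iso y' x] unfolding maximal_def by blast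
      then show "trivial_dilation scaleR y \<alpha>"
        by (rule trivial_dilation_half_isometry[OF inf iso y'])
    qed
  next
    assume max: "maximal scaleR K (double I) (c_mat x)"
    show "maximal scaleC_pair (complexification nV K) I x"
      unfolding maximal_def
    proof (intro conjI allI impI; (elim conjE)?)
      show "x \<in> complexification nV K I" by fact
      fix J z \<alpha>
      assume J: "J \<noteq> {}" and z: "z \<in> complexification nV K J" and dil: "dilation scaleC_pair I x J z \<alpha>"
      have "bounded_form (\<lambda>i j. (fst (z i j), snd (z i j)))"
        using z by (intro bounded_form_Pair bounded_form_dual_mats[OF nV]) (auto simp: complexification_def)
      then have z': "bounded_form z" by simp
      have \<alpha>: "bounded_form \<alpha>"
        using dil by (auto simp: dilation_def isometries_def intro: bounded_form_scalar_mats)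
      have "double J \<noteq> {}" using J by (auto simp: double_def)
      moreover have "c_mat z \<in> K (double J)" using z by (simp add: complexification_def)
      \<comment> \<open>c(z) dilates c(x) inside \<open>K\<close>, at the level
        \<open>double J\<close>, through the real isometry c(\<alpha>).\<close>
      ultimately have "trivial_dilation scaleR (c_mat z) (c_mat (cpair \<alpha>))"
        using max dilation_c_mat[OF inf z' dil] unfolding maximal_def by blast
      then show "trivial_dilation scaleC_pair z \<alpha>"
        using trivial_dilation_c_mat_iff[OF inf z' \<alpha>] by simp
    qed
  }
qed

end
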